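(* Let $p\ge q\ge 1$ be integers, $n=p+q$. If $\mathbf m=(m_1,\dots,m_n)$ is a Hessenberg vector such that $\mathrm{Hess}(\mathsf x_{p,q},\mathbf m)$ is irreducible, then $$\dim \mathrm{Hess}(\mathsf x_{p,q},\mathbf m)=\sum_{i=1}^n (m_i-i).$$
   Context: A Hessenberg vector of length $n$ is a weakly increasing sequence $(m_1,\dots,m_n)$ of integers with $i\le m_i\le n$ for all $i$. $\mathcal B=GL_n(\mathbb C)/B$ ($B$ upper triangular matrices) is identified with the variety of full flags $V_\bullet=(0<V_1<\dots<V_n=\mathbb C^n)$, $\dim V_i=i$. For an $n\times n$ complex matrix $\mathsf x$, $\mathrm{Hess}(\mathsf x,\mathbf m)=\{V_\bullet\in\mathcal B : \mathsf x V_i\le V_{m_i}\text{ for all } i\}$. Here $\mathsf x_{p,q}=\mathrm{diag}(\lambda_1,\dots,\lambda_1,\lambda_2,\dots,\lambda_2)$ ($p$ copies of $\lambda_1$, $q$ copies of $\lambda_2$) with $\lambda_1\neq\lambda_2$ in $\mathbb C$. *)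

theory Defs
  imports
    "HOL-Analysis.Abstract_Topology"
    "HOL-Library.Extended_Nat"
    "Jordan_Normal_Form.DL_Rank"
begin

section \<open>Irreducible spaces and Krull dimension\<close>

text \<open>Irreducible spaces are nonempty by convention.\<close>

definition irreducible_space :: "'a topology \<Rightarrow> bool" where
  "irreducible_space X \<longleftrightarrow>
     topspace X \<noteq> {} \<and>
     (\<forall>A B. closedin X A \<and> closedin X B \<and> topspace X = A \<union> B \<longrightarrow>
        A = topspace X \<or> B = topspace X)"

text \<open>The supremum of the lengths \<open>d\<close> of chains
  \<open>Z 0 \<subset> Z 1 \<subset> \<dots> \<subset> Z d\<close> of irreducible closed subsets.
  (The empty space gets dimension \<open>0\<close>, since \<^typ>\<open>enat\<close> has no \<open>- \<infinity>\<close>.)\<close>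

definition krull_dim :: "'a topology \<Rightarrow> enat" where
  "krull_dim X = Sup {enat d | d. \<exists>Z :: nat \<Rightarrow> 'a set.
     (\<forall>i\<le>d. closedin X (Z i) \<and> irreducible_space (subtopology X (Z i))) \<and>
     (\<forall>i<d. Z i \<subset> Z (Suc i))}"


section \<open>The Zariski topology on matrices and on the general linear group\<close>

inductive_set mat_poly_funs :: "nat \<Rightarrow> (complex mat \<Rightarrow> complex) set" for n :: nat where
  const: "(\<lambda>_. c) \<in> mat_poly_funs n"
| entry: "i < n \<Longrightarrow> j < n \<Longrightarrow> (\<lambda>A. A $$ (i, j)) \<in> mat_poly_funs n"
| add: "f \<in> mat_poly_funs n \<Longrightarrow> g \<in> mat_poly_funs n \<Longrightarrow> (\<lambda>A. f A + g A) \<in> mat_poly_funs n"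
| mult: "f \<in> mat_poly_funs n \<Longrightarrow> g \<in> mat_poly_funs n \<Longrightarrow> (\<lambda>A. f A * g A) \<in> mat_poly_funs n"

definition mat_zeros :: "nat \<Rightarrow> (complex mat \<Rightarrow> complex) set \<Rightarrow> complex mat set" where
  "mat_zeros n S = {A \<in> carrier_mat n n. \<forall>f\<in>S. f A = 0}"

definition zariski_mat :: "nat \<Rightarrow> complex mat topology" where
  "zariski_mat n = topology (\<lambda>U. \<exists>S \<subseteq> mat_poly_funs n. U = carrier_mat n n - mat_zeros n S)"

definition GL :: "nat \<Rightarrow> complex mat set" where
  "GL n = {g \<in> carrier_mat n n. invertible_mat g}"

text \<open>As \<open>GL n\<close> is open in the space of all matrices, its Zariski topology as an
  affine variety (with coordinate ring generated by the entries and \<open>1 / det\<close>) is the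
  subspace topology.\<close>

definition zariski_GL :: "nat \<Rightarrow> complex mat topology" where
  "zariski_GL n = subtopology (zariski_mat n) (GL n)"

lemma istopology_zariski_mat:
  "istopology (\<lambda>U. \<exists>S \<subseteq> mat_poly_funs n. U = carrier_mat n n - mat_zeros n S)"
  unfolding istopology_def
proof (intro conjI allI impI)
  fix U V
  assume "\<exists>S \<subseteq> mat_poly_funs n. U = carrier_mat n n - mat_zeros n S"
    and "\<exists>S \<subseteq> mat_poly_funs n. V = carrier_mat n n - mat_zeros n S"
  then obtain S T where S: "S \<subseteq> mat_poly_funs n" "U = carrier_mat n n - mat_zeros n S"
    and T: "T \<subseteq> mat_poly_funs n" "V = carrier_mat n n - mat_zeros n T"
    by blast
  let ?R = "{\<lambda>A. f A * g A | f g. f \<in> S \<and> g \<in> T}"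
  have "?R \<subseteq> mat_poly_funs n"
    using S(1) T(1) by (auto intro: mat_poly_funs.mult)
  moreover have "U \<inter> V = carrier_mat n n - mat_zeros n ?R"
    unfolding S(2) T(2) mat_zeros_def by fastforce
  ultimately show "\<exists>S \<subseteq> mat_poly_funs n. U \<inter> V = carrier_mat n n - mat_zeros n S"
    by blast
next
  fix K
  assume "\<forall>U\<in>K. \<exists>S \<subseteq> mat_poly_funs n. U = carrier_mat n n - mat_zeros n S"
  then obtain S where S: "\<And>U. U \<in> K \<Longrightarrow> S U \<subseteq> mat_poly_funs n"
      "\<And>U. U \<in> K \<Longrightarrow> U = carrier_mat n n - mat_zeros n (S U)"
    by metis
  have "(\<Union>U\<in>K. S U) \<subseteq> mat_poly_funs n"
    using S(1) by blast
  moreover have "\<Union>K = (\<Union>U\<in>K. carrier_mat n n - mat_zeros n (S U))"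
    using S(2) by auto
  then have "\<Union>K = carrier_mat n n - mat_zeros n (\<Union>U\<in>K. S U)"
    unfolding mat_zeros_def by blast
  ultimately show "\<exists>S \<subseteq> mat_poly_funs n. \<Union>K = carrier_mat n n - mat_zeros n S"
    by blast
qed

lemma openin_zariski_mat:
  "openin (zariski_mat n) U \<longleftrightarrow> (\<exists>S \<subseteq> mat_poly_funs n. U = carrier_mat n n - mat_zeros n S)"
  unfolding zariski_mat_def by (simp add: topology_inverse' istopology_zariski_mat)

lemma topspace_zariski_mat [simp]: "topspace (zariski_mat n) = carrier_mat n n"
proof
  show "topspace (zariski_mat n) \<subseteq> carrier_mat n n"
    unfolding topspace_def openin_zariski_mat by blast
  have "carrier_mat n n = carrier_mat n n - mat_zeros n {\<lambda>_. 1}"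
    unfolding mat_zeros_def by simp
  then have "openin (zariski_mat n) (carrier_mat n n)"
    unfolding openin_zariski_mat
    by (intro exI[of _ "{\<lambda>_. 1}"]) (auto intro: mat_poly_funs.const)
  then show "carrier_mat n n \<subseteq> topspace (zariski_mat n)"
    by (rule openin_subset)
qed

lemma closedin_zariski_mat:
  "closedin (zariski_mat n) Z \<longleftrightarrow> (\<exists>S \<subseteq> mat_poly_funs n. Z = mat_zeros n S)"
proof -
  have *: "mat_zeros n S \<subseteq> carrier_mat n n" for S
    unfolding mat_zeros_def by blast
  show ?thesis
    unfolding closedin_def openin_zariski_mat topspace_zariski_mat
    by (metis * Diff_Diff_Int inf.absorb_iff2)
qed

lemma topspace_zariski_GL [simp]: "topspace (zariski_GL n) = GL n"
  unfolding zariski_GL_def by (auto simp: GL_def)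


section \<open>The flag variety\<close>

definition subspace_of_dim :: "nat \<Rightarrow> nat \<Rightarrow> complex vec set \<Rightarrow> bool" where
  "subspace_of_dim n d W \<longleftrightarrow>
     VectorSpace.subspace class_ring W (module_vec TYPE(complex) n) \<and>
     vectorspace.dim class_ring ((module_vec TYPE(complex) n)\<lparr>carrier := W\<rparr>) = d"

text \<open>A flag is the family of its members \<open>V 1, \<dots>, V n\<close>; extensionality makes equality of
  functions coincide with equality of flags.\<close>

definition flags :: "nat \<Rightarrow> (nat \<Rightarrow> complex vec set) set" where
  "flags n = {V \<in> extensional {1..n}.
     (\<forall>i\<in>{1..n}. subspace_of_dim n i (V i)) \<and> (\<forall>i\<in>{1..<n}. V i \<subseteq> V (Suc i))}"

text \<open>The flag corresponding to the coset \<open>g B\<close>: its \<open>i\<close>-th member is spanned by the first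
  \<open>i\<close> columns of \<open>g\<close>.\<close>

definition flag_of :: "nat \<Rightarrow> complex mat \<Rightarrow> nat \<Rightarrow> complex vec set" where
  "flag_of n g = (\<lambda>i\<in>{1..n}.
     LinearCombinations.module.span class_ring (module_vec TYPE(complex) n)
       (set (take i (cols g))))"

text \<open>The Zariski topology on \<open>GL n / B\<close> is the quotient topology of that on \<open>GL n\<close>; it is
  carried over to flags by \<open>g B \<mapsto> flag_of n g\<close>.\<close>

definition flag_variety :: "nat \<Rightarrow> (nat \<Rightarrow> complex vec set) topology" where
  "flag_variety n = topology (\<lambda>U. U \<subseteq> flags n \<and>
     openin (zariski_GL n) {g \<in> GL n. flag_of n g \<in> U})"

lemma istopology_flag_variety:
  "istopology (\<lambda>U. U \<subseteq> flags n \<and> openin (zariski_GL n) {g \<in> GL n. flag_of n g \<in> U})"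
  unfolding istopology_def
proof (intro conjI allI impI)
  fix U V
  assume "U \<subseteq> flags n \<and> openin (zariski_GL n) {g \<in> GL n. flag_of n g \<in> U}"
    and "V \<subseteq> flags n \<and> openin (zariski_GL n) {g \<in> GL n. flag_of n g \<in> V}"
  moreover have "{g \<in> GL n. flag_of n g \<in> U \<inter> V} =
      {g \<in> GL n. flag_of n g \<in> U} \<inter> {g \<in> GL n. flag_of n g \<in> V}"
    by blast
  ultimately show "U \<inter> V \<subseteq> flags n"
    and "openin (zariski_GL n) {g \<in> GL n. flag_of n g \<in> U \<inter> V}"
    by auto
next
  fix K
  assume K: "\<forall>U\<in>K. U \<subseteq> flags n \<and> openin (zariski_GL n) {g \<in> GL n. flag_of n g \<in> U}"
  then show "\<Union>K \<subseteq> flags n"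
    by blast
  have "{g \<in> GL n. flag_of n g \<in> \<Union>K} = (\<Union>U\<in>K. {g \<in> GL n. flag_of n g \<in> U})"
    by blast
  also have "openin (zariski_GL n) \<dots>"
    using K by (intro openin_Union) auto
  finally show "openin (zariski_GL n) {g \<in> GL n. flag_of n g \<in> \<Union>K}" .
qed

lemma openin_flag_variety:
  "openin (flag_variety n) U \<longleftrightarrow>
     U \<subseteq> flags n \<and> openin (zariski_GL n) {g \<in> GL n. flag_of n g \<in> U}"
  unfolding flag_variety_def by (simp add: topology_inverse' istopology_flag_variety)

lemma GL_cols:
  assumes "g \<in> GL n"
  shows "distinct (cols g)" "\<not> module.lin_dep class_ring (module_vec TYPE(complex) n) (set (cols g))"
    "set (cols g) \<subseteq> carrier_vec n" "length (cols g) = n"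
proof -
  interpret vec_space "TYPE(complex)" n .
  have g: "g \<in> carrier_mat n n" and inv: "invertible_mat g" using assms by (auto simp: GL_def)
  obtain h where h: "inverts_mat g h" "inverts_mat h g" using inv unfolding invertible_mat_def by blast
  have gh: "g * h = 1\<^sub>m n" using h(1) g unfolding inverts_mat_def by auto
  have hg: "h * g = 1\<^sub>m (dim_row h)" using h(2) unfolding inverts_mat_def by auto
  have "dim_col h = n" using arg_cong[OF gh, of dim_col] by simp
  moreover have "dim_row h = n" using arg_cong[OF hg, of dim_col] g by simp
  ultimately have hc: "h \<in> carrier_mat n n" by auto
  have "det g * det h = 1" using det_mult[OF g hc] gh by (metis det_one)
  then have d: "det g \<noteq> 0" by auto
  show "lin_indpt (set (cols g))" using lin_dep_cols_imp_det_0[OF g] d by blast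
  show "distinct (cols g)" using non_distinct_low_rank[OF g] d det_rank_iff[OF g] by auto
  show "set (cols g) \<subseteq> carrier_vec n" using g cols_dim by blast
  show "length (cols g) = n" using g by simp
qed

context vec_space begin

lemma span_dim_card:
  assumes "S \<subseteq> carrier_vec n" "finite S" "lin_indpt S"
  shows "vectorspace.dim class_ring (span_vs S) = card S"
  using assms by (intro dim_span) (auto simp: maximal_def)

lemma subspace_fin_dim:
  assumes W: "VectorSpace.subspace class_ring W V"
  shows "vectorspace.fin_dim class_ring (vs W)"
proof -
  interpret W: vectorspace class_ring "vs W" by (rule subspace_is_vs[OF W])
  have sm: "submodule class_ring W V" using W by simp
  have sub: "W \<subseteq> carrier_vec n" using sm unfolding submodule_def by simp
  have bd: "finite A \<and> card A \<le> n" if "A \<subseteq> W" "W.lin_indpt A" for A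
  proof -
    have "lin_indpt A" using span_li_not_depend(2)[OF that(1) sm] that(2) by simp
    then show ?thesis using li_le_dim[of A] that(1) sub fin_dim dim_is_n by auto
  qed
  have "W.lin_indpt {}" unfolding W.lin_dep_def by auto
  then have "\<exists>A. (A \<subseteq> W \<and> W.lin_indpt A) \<and> (\<forall>B. B \<subseteq> W \<and> W.lin_indpt B \<longrightarrow> card B \<le> card A)"
    using bd by (intro ex_has_greatest_nat[where b = "Suc n" and k = "{}"]) (auto simp: less_Suc_eq_le)
  then obtain A where A: "A \<subseteq> W" "W.lin_indpt A" and
      mx: "\<And>B. B \<subseteq> W \<Longrightarrow> W.lin_indpt B \<Longrightarrow> card B \<le> card A"
    by blast
  have eq: "B = A" if "A \<subseteq> B" "B \<subseteq> W" "W.lin_indpt B" for B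
    using card_seteq[of B A] bd[of B] mx[of B] that by auto
  have "W.basis A"
  proof (rule W.max_li_is_basis)
    show "maximal A (\<lambda>S. S \<subseteq> carrier (vs W) \<and> W.lin_indpt S)"
      unfolding maximal_def using A eq by auto
  qed
  then show ?thesis unfolding W.fin_dim_def W.basis_def using bd A by auto
qed

lemma span_eq_subspace:
  assumes W: "VectorSpace.subspace class_ring W V"
    and "S \<subseteq> W" "lin_indpt S" "card S = vectorspace.dim class_ring (vs W)" "finite S"
  shows "span S = W"
proof -
  interpret W: vectorspace class_ring "vs W" by (rule subspace_is_vs[OF W])
  have sm: "submodule class_ring W V" using W by simp
  have "W.basis S" using assms span_li_not_depend(2)[OF assms(2) sm]
    by (intro W.dim_li_is_basis subspace_fin_dim) auto
  then show ?thesis unfolding W.basis_def using span_li_not_depend(1)[OF assms(2) sm] by simp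
qed

end

lemma flag_of_in_flags: assumes "g \<in> GL n" shows "flag_of n g \<in> flags n"
proof -
  interpret vec_space "TYPE(complex)" n .
  note c = GL_cols[OF assms]
  have ss: "set (take i (cols g)) \<subseteq> carrier_vec n" for i using c(3) set_take_subset by fast
  have li: "lin_indpt (set (take i (cols g)))" for i using subset_li_is_li[OF c(2) set_take_subset] .
  have "card (set (take i (cols g))) = i" if "i \<le> n" for i
    using c(1,4) that by (simp add: distinct_card)
  then have "subspace_of_dim n i (span (set (take i (cols g))))" if "i \<le> n" for i
    unfolding subspace_of_dim_def using that ss span_dim_card[OF ss _ li] 
    by (auto simp: span_is_subspace)
  moreover have "span (set (take i (cols g))) \<subseteq> span (set (take (Suc i) (cols g)))" for i
    by (rule span_is_monotone) (simp add: set_take_subset_set_take)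
  ultimately show ?thesis unfolding flags_def flag_of_def by auto
qed

lemma flag_of_surj: assumes F: "F \<in> flags n" shows "\<exists>g\<in>GL n. flag_of n g = F"
proof -
  interpret vec_space "TYPE(complex)" n .
  have sp: "VectorSpace.subspace class_ring (F i) V" "vectorspace.dim class_ring (vs (F i)) = i"
    if "1 \<le> i" "i \<le> n" for i using F that by (auto simp: flags_def subspace_of_dim_def)
  have car: "F i \<subseteq> carrier_vec n" if "1 \<le> i" "i \<le> n" for i
    using sp(1)[OF that] unfolding VectorSpace.subspace_def submodule_def by simp
  have "\<exists>ws. length ws = k \<and> distinct ws \<and> set ws \<subseteq> carrier_vec n \<and> lin_indpt (set ws) \<and>
     (\<forall>i. 1 \<le> i \<and> i \<le> k \<longrightarrow> span (set (take i ws)) = F i)" if "k \<le> n" for k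
    using that
  proof (induction k)
    case 0
    then show ?case by (auto simp: lin_dep_def)
  next
    case (Suc k)
    then obtain ws where ws: "length ws = k" "distinct ws" "set ws \<subseteq> carrier_vec n" 
      "lin_indpt (set ws)" "\<And>i. 1 \<le> i \<Longrightarrow> i \<le> k \<Longrightarrow> span (set (take i ws)) = F i" by auto
    let ?W = "F (Suc k)"
    have s: "VectorSpace.subspace class_ring ?W V" "vectorspace.dim class_ring (vs ?W) = Suc k"
      using sp[of "Suc k"] Suc.prems by auto
    have sm: "submodule class_ring ?W V" using s by simp
    have wsW: "set ws \<subseteq> ?W"
    proof (cases "k = 0")
      case False
      then have "F k \<subseteq> ?W" using F Suc.prems by (auto simp: flags_def)
      moreover have "span (set ws) = F k" using ws(5)[of k] ws(1) False by auto
      ultimately show ?thesis using in_own_span[of "set ws"] ws(3) by auto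
    qed (use ws in auto)
    have "\<exists>v\<in>?W. v \<notin> span (set ws)"
    proof (rule ccontr)
      assume "\<not> ?thesis"
      then have "?W \<subseteq> span (set ws)" by blast
      moreover have "span (set ws) \<subseteq> ?W" using span_is_subset[OF wsW sm] by simp
      ultimately have "span (set ws) = ?W" by blast
      then have "Suc k = card (set ws)" using span_dim_card[OF ws(3) _ ws(4)] s(2) by simp
      then show False using ws by (simp add: distinct_card)
    qed
    then obtain v where v: "v \<in> ?W" "v \<notin> span (set ws)" by blast
    have vc: "v \<in> carrier_vec n" using v(1) car[of "Suc k"] Suc.prems by auto
    have vn: "v \<notin> set ws" using v(2) in_own_span[of "set ws"] ws(3) by auto
    have li: "lin_indpt (set (ws @ [v]))"
      using lin_dep_iff_in_span[of "set ws" v] ws v vc vn by auto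
    have "span (set (ws @ [v])) = ?W"
      by (rule span_eq_subspace[OF s(1) _ li]) (use s wsW v vn ws in \<open>auto simp: distinct_card\<close>)
    then show ?case using ws vc vn li
      by (intro exI[of _ "ws @ [v]"]) (auto simp: le_Suc_eq)
  qed
  from this[of n] obtain ws where ws: "length ws = n" "distinct ws" "set ws \<subseteq> carrier_vec n" 
      "lin_indpt (set ws)" "\<And>i. 1 \<le> i \<Longrightarrow> i \<le> n \<Longrightarrow> span (set (take i ws)) = F i" by auto
  let ?g = "mat_of_cols n ws"
  have g: "?g \<in> carrier_mat n n" using ws(1) mat_of_cols_carrier(1) by blast
  have c: "cols ?g = ws" using ws(3) by simp
  have "rank ?g = n" using lin_indpt_full_rank[OF g] c ws by simp
  then have "det ?g \<noteq> 0" using det_rank_iff[OF g] by simp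
  then have "?g \<in> Units (ring_mat TYPE(complex) n undefined)" using det_non_zero_imp_unit[OF g] by simp
  then have "invertible_mat ?g" using g unfolding Units_def invertible_mat_def inverts_mat_def
    by (auto simp: ring_mat_def)
  then have "?g \<in> GL n" using g by (simp add: GL_def)
  moreover have "flag_of n ?g = F"
    using F ws(5) unfolding flag_of_def c by (intro ext) (auto simp: flags_def extensional_def)
  ultimately show ?thesis by blast
qed

lemma quotient_map_flag_of: "quotient_map (zariski_GL n) (flag_variety n) (flag_of n)"
proof -
  have t: "topspace (flag_variety n) = flags n"
  proof
    show "topspace (flag_variety n) \<subseteq> flags n" unfolding topspace_def openin_flag_variety by blast
    have "{g \<in> GL n. flag_of n g \<in> flags n} = topspace (zariski_GL n)" using flag_of_in_flags by auto
    then have "openin (flag_variety n) (flags n)" unfolding openin_flag_variety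
      using openin_topspace[of "zariski_GL n"] by simp
    then show "flags n \<subseteq> topspace (flag_variety n)" by (rule openin_subset)
  qed
  show ?thesis unfolding quotient_map_def t
    using flag_of_in_flags flag_of_surj by (auto simp: openin_flag_variety) force+
qed


section \<open>Hessenberg varieties\<close>

definition hessenberg_vector :: "nat \<Rightarrow> (nat \<Rightarrow> nat) \<Rightarrow> bool" where
  "hessenberg_vector n m \<longleftrightarrow>
     mono_on {1..n} m \<and> (\<forall>i\<in>{1..n}. i \<le> m i \<and> m i \<le> n)"

definition Hess :: "nat \<Rightarrow> complex mat \<Rightarrow> (nat \<Rightarrow> nat) \<Rightarrow> (nat \<Rightarrow> complex vec set) set" where
  "Hess n x m = {V \<in> flags n. \<forall>i\<in>{1..n}. \<forall>v\<in>V i. x *\<^sub>v v \<in> V (m i)}"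

definition hessenberg_variety ::
    "nat \<Rightarrow> complex mat \<Rightarrow> (nat \<Rightarrow> nat) \<Rightarrow> (nat \<Rightarrow> complex vec set) topology" where
  "hessenberg_variety n x m = subtopology (flag_variety n) (Hess n x m)"

definition diag_two :: "nat \<Rightarrow> nat \<Rightarrow> complex \<Rightarrow> complex \<Rightarrow> complex mat" where
  "diag_two p q a b =
     mat_diag (p + q) (\<lambda>i. if i < p then a else b)"

end

theory Submission
  imports Defs
begin

text \<open>
  Let \<open>X\<close> be the preimage of the Hessenberg variety in \<open>GL n\<close>.  Irreducibility yields a
  matrix \<open>g \<in> X\<close> such that the span of its first \<open>p\<close> columns is transversal to the
  \<open>b\<close>-eigenspace of \<open>x\<close> and that of its first \<open>q\<close> columns to the \<open>a\<close>-eigenspace, because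
  flags of either kind occur among the flags fixed by \<open>x\<close>; this forces \<open>m 1 \<ge> p\<close> and
  \<open>m q = n\<close>.  Only the conditions for the first \<open>q\<close> columns are then left, and the open subset
  of \<open>X\<close> where the top left \<open>p \<times> p\<close> minor does not vanish lies in the image of a polynomial map
  with \<open>\<Sum> m i\<close> parameters.

  Dimensions are measured by the growth of the number of independent polynomial functions of
  bounded degree: its exponent is at most the number of parameters, and each proper step in a
  chain of irreducible closed sets raises it by at least one.  A chain of length \<open>d\<close> in the
  Hessenberg variety pulls back to \<open>X\<close> and is prolonged below by \<open>n (n + 1) / 2\<close> steps inside a
  coset of the Borel subgroup, hence \<open>d + n (n + 1) / 2 \<le> \<Sum> m i\<close>.  Equality is attained by the
  closures of the images of the coordinate subspaces of the unipotent parameters.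
\<close>

section \<open>Growth of the number of independent polynomial functions\<close>

text \<open>\<open>k\<close> is only an upper bound for the degree, witnessed by a way of building
  the function; no normal form of polynomials has to be chosen.\<close>

inductive mat_poly_deg :: "nat \<Rightarrow> nat \<Rightarrow> (complex mat \<Rightarrow> complex) \<Rightarrow> bool" for n :: nat where
  const: "mat_poly_deg n k (\<lambda>_. c)"
| entry: "i < n \<Longrightarrow> j < n \<Longrightarrow> mat_poly_deg n 1 (\<lambda>A. A $$ (i, j))"
| add: "mat_poly_deg n k f \<Longrightarrow> mat_poly_deg n k g \<Longrightarrow> mat_poly_deg n k (\<lambda>A. f A + g A)"
| mult: "mat_poly_deg n k f \<Longrightarrow> mat_poly_deg n l g \<Longrightarrow> mat_poly_deg n (k + l) (\<lambda>A. f A * g A)"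
| mono: "mat_poly_deg n k f \<Longrightarrow> k \<le> l \<Longrightarrow> mat_poly_deg n l f"

lemma mat_poly_deg_imp_poly: "mat_poly_deg n k f \<Longrightarrow> f \<in> mat_poly_funs n"
  by (induction rule: mat_poly_deg.induct) (auto intro: mat_poly_funs.intros)

lemma mat_poly_imp_deg: "f \<in> mat_poly_funs n \<Longrightarrow> \<exists>k. mat_poly_deg n k f"
proof (induction rule: mat_poly_funs.induct)
  case (add f g)
  then obtain k l where "mat_poly_deg n k f" "mat_poly_deg n l g" by blast
  then have "mat_poly_deg n (max k l) f" "mat_poly_deg n (max k l) g"
    by (auto elim: mat_poly_deg.mono)
  then show ?case by (blast intro: mat_poly_deg.add)
qed (blast intro: mat_poly_deg.intros)+

lemma mat_poly_deg_sum:
  assumes "\<And>i. i \<in> I \<Longrightarrow> mat_poly_deg n k (f i)"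
  shows "mat_poly_deg n k (\<lambda>A. \<Sum>i\<in>I. f i A)"
  using assms
  by (induction I rule: infinite_finite_induct) (auto intro: mat_poly_deg.const mat_poly_deg.add)

lemma mat_poly_deg_scale: "mat_poly_deg n k f \<Longrightarrow> mat_poly_deg n k (\<lambda>A. c * f A)"
  using mat_poly_deg.mult[OF mat_poly_deg.const[of n 0 c]] by simp

lemma mat_poly_sum:
  assumes "\<And>i. i \<in> I \<Longrightarrow> f i \<in> mat_poly_funs n"
  shows "(\<lambda>A. \<Sum>i\<in>I. f i A) \<in> mat_poly_funs n"
  using assms
  by (induction I rule: infinite_finite_induct) (auto intro: mat_poly_funs.const mat_poly_funs.add)

lemma mat_poly_prod:
  assumes "\<And>i. i \<in> I \<Longrightarrow> f i \<in> mat_poly_funs n"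
  shows "(\<lambda>A. \<Prod>i\<in>I. f i A) \<in> mat_poly_funs n"
  using assms
  by (induction I rule: infinite_finite_induct) (auto intro: mat_poly_funs.const mat_poly_funs.mult)

definition indep_funs :: "'a set \<Rightarrow> nat \<Rightarrow> (nat \<Rightarrow> 'a \<Rightarrow> complex) \<Rightarrow> bool" where
  "indep_funs Z N F \<longleftrightarrow>
     (\<forall>c. (\<forall>z\<in>Z. (\<Sum>i<N. c i * F i z) = 0) \<longrightarrow> (\<forall>i<N. c i = 0))"

text \<open>Lower bounds for the affine Hilbert function: \<open>N\<close> is at most the dimension
  of the space of restrictions to \<open>Z\<close> of polynomials of degree at most
  \<open>k\<close>.\<close>

definition hilbert_ge :: "nat \<Rightarrow> complex mat set \<Rightarrow> nat \<Rightarrow> nat \<Rightarrow> bool" where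
  "hilbert_ge n Z k N \<longleftrightarrow> (\<exists>F. (\<forall>i<N. mat_poly_deg n k (F i)) \<and> indep_funs Z N F)"

text \<open>\<open>K + d choose d\<close> counts the monomials of degree at most \<open>K\<close> in
  \<open>d\<close> variables, so this serves as the statement that the closure of \<open>Z\<close>
  has dimension at least \<open>d\<close>. The factor \<open>E\<close> leaves room for the degrees
  of the functions that separate the steps of a chain.\<close>

definition growth_ge :: "nat \<Rightarrow> complex mat set \<Rightarrow> nat \<Rightarrow> bool" where
  "growth_ge n Z d \<longleftrightarrow> (\<exists>E. \<forall>K. hilbert_ge n Z (K * E) (K + d choose d))"

text \<open>Primality of the vanishing ideal of \<open>Z\<close>, except that \<open>Z\<close> may be empty.\<close>

definition zariski_prime :: "nat \<Rightarrow> complex mat set \<Rightarrow> bool" where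
  "zariski_prime n Z \<longleftrightarrow> (\<forall>f\<in>mat_poly_funs n. \<forall>g\<in>mat_poly_funs n.
     (\<forall>z\<in>Z. f z * g z = 0) \<longrightarrow> (\<forall>z\<in>Z. f z = 0) \<or> (\<forall>z\<in>Z. g z = 0))"

lemma hilbert_ge_one: "Z \<noteq> {} \<Longrightarrow> hilbert_ge n Z k 1"
  unfolding hilbert_ge_def indep_funs_def
  by (intro exI[of _ "\<lambda>_ _. 1"]) (auto intro: mat_poly_deg.const)

text \<open>A relation between functions independent on \<open>Z\<close> and multiples of \<open>h\<close> restricts to \<open>Z\<close>,
  where \<open>h\<close> vanishes, and \<open>h\<close> can be cancelled from what remains.\<close>

lemma hilbert_ge_add:
  assumes Z: "hilbert_ge n Z k N" and Z': "hilbert_ge n Z' k' N'"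
    and sub: "Z \<subseteq> Z'" and pr: "zariski_prime n Z'"
    and h: "mat_poly_deg n e h" "\<And>z. z \<in> Z \<Longrightarrow> h z = 0" "y \<in> Z'" "h y \<noteq> 0"
    and le: "k \<le> l" "k' + e \<le> l"
  shows "hilbert_ge n Z' l (N + N')"
proof -
  obtain F G where F: "\<And>i. i < N \<Longrightarrow> mat_poly_deg n k (F i)" "indep_funs Z N F"
    and G: "\<And>i. i < N' \<Longrightarrow> mat_poly_deg n k' (G i)" "indep_funs Z' N' G"
    using Z Z' unfolding hilbert_ge_def by blast
  define H where "H i = (if i < N then F i else (\<lambda>A. G (i - N) A * h A))" for i
  have "mat_poly_deg n l (H i)" if "i < N + N'" for i
  proof (cases "i < N")
    case True
    then show ?thesis using F(1) le(1) unfolding H_def by (auto intro: mat_poly_deg.mono)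
  next
    case False
    then have "mat_poly_deg n k' (G (i - N))" using that by (intro G) auto
    then have "mat_poly_deg n (k' + e) (\<lambda>A. G (i - N) A * h A)"
      using h(1) by (rule mat_poly_deg.mult)
    then show ?thesis unfolding H_def using False le(2) by (auto intro: mat_poly_deg.mono)
  qed
  moreover have "indep_funs Z' (N + N') H"
    unfolding indep_funs_def
  proof (intro allI impI)
    fix c i assume c: "\<forall>z\<in>Z'. (\<Sum>i<N + N'. c i * H i z) = 0" and i: "i < N + N'"
    have eq: "(\<Sum>i<N + N'. c i * H i z) =
        (\<Sum>i<N. c i * F i z) + (\<Sum>j<N'. c (N + j) * G j z) * h z" for z
    proof -
      have "(\<Sum>i<N + N'. s i) = (\<Sum>i<N. s i) + (\<Sum>j<N'. s (N + j))" for s :: "nat \<Rightarrow> complex"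
        by (induction N') (auto simp: add.assoc)
      then show ?thesis by (simp add: H_def sum_distrib_right mult.assoc)
    qed
    have "(\<Sum>i<N. c i * F i z) = 0" if "z \<in> Z" for z
      using c sub h(2) that eq[of z] by auto
    then have c1: "c i = 0" if "i < N" for i using F(2) that unfolding indep_funs_def by blast
    define g where "g z = (\<Sum>j<N'. c (N + j) * G j z)" for z
    have "mat_poly_deg n k' g"
      unfolding g_def by (intro mat_poly_deg_sum mat_poly_deg_scale G) auto
    moreover have "\<forall>z\<in>Z'. g z * h z = 0" using c eq c1 by (simp add: g_def)
    ultimately have "\<forall>z\<in>Z'. g z = 0"
      using pr h unfolding zariski_prime_def by (meson mat_poly_deg_imp_poly)
    then have c2: "c (N + j) = 0" if "j < N'" for j
      using G(2) that unfolding indep_funs_def g_def by (auto dest: spec[of _ "\<lambda>j. c (N + j)"])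
    show "c i = 0"
      using c1[of i] c2[of "i - N"] i by (cases "i < N") auto
  qed
  ultimately show ?thesis unfolding hilbert_ge_def by blast
qed

lemma growth_ge_0: "Z \<noteq> {} \<Longrightarrow> growth_ge n Z 0"
  unfolding growth_ge_def using hilbert_ge_one by auto

lemma growth_ge_superset:
  assumes "growth_ge n Z d" "Z \<subseteq> Z'"
  shows "growth_ge n Z' d"
proof -
  have "indep_funs Z' N F" if "indep_funs Z N F" for N F
    using that assms(2) unfolding indep_funs_def by (meson subsetD)
  then have "hilbert_ge n Z' k N" if "hilbert_ge n Z k N" for k N
    using that unfolding hilbert_ge_def by blast
  then show ?thesis using assms(1) unfolding growth_ge_def by blast
qed

text \<open>The functions independent on \<open>Z\<close> can be multiplied by successive powers of
  \<open>h\<close>; summing the counts over these powers raises the exponent of growth by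
  one.\<close>

lemma growth_ge_Suc:
  assumes Z: "growth_ge n Z d" and sub: "Z \<subseteq> Z'" and pr: "zariski_prime n Z'"
    and h: "h \<in> mat_poly_funs n" "\<And>z. z \<in> Z \<Longrightarrow> h z = 0" "y \<in> Z'" "h y \<noteq> 0"
  shows "growth_ge n Z' (Suc d)"
proof -
  obtain E where E: "\<And>K. hilbert_ge n Z (K * E) (K + d choose d)"
    using Z unfolding growth_ge_def by blast
  obtain e where e: "mat_poly_deg n e h" using mat_poly_imp_deg h(1) by blast
  have "hilbert_ge n Z' (K * (E + e)) (K + Suc d choose Suc d)" for K
  proof (induction K)
    case 0
    show ?case using hilbert_ge_one h(3) by auto
  next
    case (Suc K)
    \<comment> \<open>Pascal's rule identifies the sum of the two counts with the next binomial
      coefficient; each multiplication by \<open>h\<close> costs \<open>e\<close> in degree, whence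
      the factor \<open>E + e\<close>.\<close>
    have "hilbert_ge n Z' (Suc K * (E + e)) ((Suc K + d choose d) + (K + Suc d choose Suc d))"
      by (rule hilbert_ge_add[OF E[of "Suc K"] Suc.IH sub pr e h(2,3,4)])
        (auto simp: algebra_simps)
    then show ?case by simp
  qed
  then show ?thesis unfolding growth_ge_def by blast
qed

section \<open>Upper bounds for the growth from polynomial parametrizations\<close>

lemma nontrivial_kernel:
  fixes A :: "nat \<Rightarrow> nat \<Rightarrow> complex"
  assumes "m < N"
  shows "\<exists>c. (\<exists>i<N. c i \<noteq> 0) \<and> (\<forall>j<m. (\<Sum>i<N. c i * A j i) = 0)"
proof -
  define B where "B = mat N N (\<lambda>(j, i). if j < m then A j i else 0)"
  have B: "B \<in> carrier_mat N N" unfolding B_def by simp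
  \<comment> \<open>\<open>B\<close> is the system padded by zero rows to a square matrix. Its row
    \<open>m\<close> is zero, so the transpose kills a unit vector and \<open>B\<close> is
    singular.\<close>
  have "transpose_mat B *\<^sub>v unit_vec N m = 0\<^sub>v N"
    using assms by (intro eq_vecI) (auto simp: B_def)
  moreover have "unit_vec N m \<noteq> (0\<^sub>v N :: complex vec)" using assms by simp
  ultimately have "det (transpose_mat B) = 0"
    using B det_0_iff_vec_prod_zero[of "transpose_mat B" N] by (auto intro!: exI[of _ "unit_vec N m"])
  then have "det B = 0" using det_transpose[OF B] by simp
  then obtain v where v: "v \<in> carrier_vec N" "v \<noteq> 0\<^sub>v N" "B *\<^sub>v v = 0\<^sub>v N"
    using det_0_iff_vec_prod_zero[OF B] by blast
  have "\<exists>i<N. v $ i \<noteq> 0" using v(1,2) by (metis carrier_vecD eq_vecI index_zero_vec)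
  moreover have "(\<Sum>i<N. v $ i * A j i) = 0" if "j < m" for j
  proof -
    have "(B *\<^sub>v v) $ j = 0" using v(3) that assms by simp
    then show ?thesis using that assms v(1)
      by (auto simp: B_def scalar_prod_def lessThan_atLeast0 mult.commute)
  qed
  ultimately show ?thesis by blast
qed

text \<open>Bounding every exponent separately, rather than the total degree, makes the exponents a
  product set with \<open>Suc r ^ card I\<close> elements. The order of growth in \<open>r\<close>
  is the same.\<close>

definition box_poly :: "'i set \<Rightarrow> nat \<Rightarrow> (('i \<Rightarrow> complex) \<Rightarrow> complex) \<Rightarrow> bool" where
  "box_poly I r f \<longleftrightarrow>
     (\<exists>c. \<forall>t. f t = (\<Sum>\<alpha>\<in>PiE I (\<lambda>_. {..r}). c \<alpha> * (\<Prod>i\<in>I. t i ^ \<alpha> i)))"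

lemma box_poly_add:
  assumes "box_poly I r f" "box_poly I r g"
  shows "box_poly I r (\<lambda>t. f t + g t)"
proof -
  obtain c d where "\<forall>t. f t = (\<Sum>\<alpha>\<in>PiE I (\<lambda>_. {..r}). c \<alpha> * (\<Prod>i\<in>I. t i ^ \<alpha> i))"
    "\<forall>t. g t = (\<Sum>\<alpha>\<in>PiE I (\<lambda>_. {..r}). d \<alpha> * (\<Prod>i\<in>I. t i ^ \<alpha> i))"
    using assms unfolding box_poly_def by blast
  then show ?thesis unfolding box_poly_def
    by (intro exI[of _ "\<lambda>\<alpha>. c \<alpha> + d \<alpha>"]) (simp add: sum.distrib distrib_right)
qed

lemma box_poly_scale:
  assumes "box_poly I r f"
  shows "box_poly I r (\<lambda>t. a * f t)"
proof -
  obtain c where "\<forall>t. f t = (\<Sum>\<alpha>\<in>PiE I (\<lambda>_. {..r}). c \<alpha> * (\<Prod>i\<in>I. t i ^ \<alpha> i))"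
    using assms unfolding box_poly_def by blast
  then show ?thesis unfolding box_poly_def
    by (intro exI[of _ "\<lambda>\<alpha>. a * c \<alpha>"]) (simp add: sum_distrib_left mult.assoc)
qed

lemma box_poly_monomial:
  assumes "finite I" "\<And>i. i \<in> I \<Longrightarrow> \<alpha> i \<le> r"
  shows "box_poly I r (\<lambda>t. \<Prod>i\<in>I. t i ^ \<alpha> i)"
  unfolding box_poly_def
proof (intro exI allI)
  fix t :: "_ \<Rightarrow> complex"
  have fin: "finite (PiE I (\<lambda>_. {..r}))" using assms(1) by (intro finite_PiE) auto
  have mem: "restrict \<alpha> I \<in> PiE I (\<lambda>_. {..r})" using assms(2) by auto
  have "(\<Sum>\<beta>\<in>PiE I (\<lambda>_. {..r}). (if \<beta> = restrict \<alpha> I then 1 else 0) * (\<Prod>i\<in>I. t i ^ \<beta> i)) =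
      (\<Sum>\<beta>\<in>PiE I (\<lambda>_. {..r}). (if \<beta> = restrict \<alpha> I then (\<Prod>i\<in>I. t i ^ \<beta> i) else 0))"
    by (intro sum.cong) auto
  also have "\<dots> = (\<Prod>i\<in>I. t i ^ restrict \<alpha> I i)" using fin mem by simp
  also have "\<dots> = (\<Prod>i\<in>I. t i ^ \<alpha> i)" by (intro prod.cong) auto
  finally show "(\<Prod>i\<in>I. t i ^ \<alpha> i) = (\<Sum>\<beta>\<in>PiE I (\<lambda>_. {..r}).
      (if \<beta> = restrict \<alpha> I then 1 else 0) * (\<Prod>i\<in>I. t i ^ \<beta> i))" by simp
qed

lemma box_poly_const: "finite I \<Longrightarrow> box_poly I r (\<lambda>t. c)"
  using box_poly_scale[OF box_poly_monomial[of I "\<lambda>_. 0" r], of c] by simp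

lemma box_poly_var:
  assumes "finite I" "j \<in> I"
  shows "box_poly I 1 (\<lambda>t. t j)"
proof -
  have "(\<Prod>i\<in>I. t i ^ (if i = j then 1 else 0)) = t j" for t :: "_ \<Rightarrow> complex"
    using assms by (simp add: if_distrib[of "\<lambda>k. _ ^ k"] cong: if_cong)
  then show ?thesis using box_poly_monomial[OF assms(1), of "\<lambda>i. if i = j then 1 else 0" 1] by simp
qed

lemma box_poly_sum:
  assumes "finite I" "\<And>s. s \<in> S \<Longrightarrow> box_poly I r (f s)"
  shows "box_poly I r (\<lambda>t. \<Sum>s\<in>S. f s t)"
  using assms(2) by (induction S rule: infinite_finite_induct)
    (auto intro: box_poly_const[OF assms(1)] box_poly_add)

lemma box_poly_mult:
  assumes "finite I" "box_poly I r f" "box_poly I s g"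
  shows "box_poly I (r + s) (\<lambda>t. f t * g t)"
proof -
  let ?R = "PiE I (\<lambda>_. {..r})" and ?S = "PiE I (\<lambda>_. {..s})"
  obtain c d where c: "\<And>t. f t = (\<Sum>\<alpha>\<in>?R. c \<alpha> * (\<Prod>i\<in>I. t i ^ \<alpha> i))"
    and d: "\<And>t. g t = (\<Sum>\<alpha>\<in>?S. d \<alpha> * (\<Prod>i\<in>I. t i ^ \<alpha> i))"
    using assms unfolding box_poly_def by blast
  have "f t * g t = (\<Sum>\<alpha>\<in>?R. \<Sum>\<beta>\<in>?S. c \<alpha> * d \<beta> * (\<Prod>i\<in>I. t i ^ (\<alpha> i + \<beta> i)))" for t
    unfolding c d sum_product by (simp add: power_add prod.distrib mult_ac)
  moreover have "box_poly I (r + s) (\<lambda>t. \<Sum>\<alpha>\<in>?R. \<Sum>\<beta>\<in>?S. c \<alpha> * d \<beta> * (\<Prod>i\<in>I. t i ^ (\<alpha> i + \<beta> i)))"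
    using assms(1)
    by (intro box_poly_sum box_poly_scale box_poly_monomial) (auto simp: PiE_iff intro!: add_mono)
  ultimately show ?thesis by simp
qed

lemma box_poly_mono:
  assumes "finite I" "box_poly I r f" "r \<le> s"
  shows "box_poly I s f"
  using box_poly_mult[OF assms(1,2) box_poly_const[OF assms(1), of "s - r" 1]] assms(3) by simp

text \<open>\<open>Suc r ^ card I\<close> is the number of available monomials, and more functions
  than that have linearly dependent coefficients.\<close>

lemma indep_funs_box_poly:
  assumes I: "finite I" and ind: "indep_funs UNIV N F" and F: "\<And>i. i < N \<Longrightarrow> box_poly I r (F i)"
  shows "N \<le> Suc r ^ card I"
proof (rule ccontr)
  assume "\<not> N \<le> Suc r ^ card I"
  let ?R = "PiE I (\<lambda>_. {..r})"
  have card: "card ?R = Suc r ^ card I" using I by (simp add: card_PiE)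
  have finR: "finite ?R" using I by (intro finite_PiE) auto
  then obtain e where e: "bij_betw e {..<card ?R} ?R"
    using bij_betw_from_nat_into_finite by blast
  obtain c where c: "\<And>i t. i < N \<Longrightarrow> F i t = (\<Sum>\<alpha>\<in>?R. c i \<alpha> * (\<Prod>j\<in>I. t j ^ \<alpha> j))"
    using F unfolding box_poly_def by metis
  obtain a where a: "\<exists>i<N. a i \<noteq> 0" "\<And>j. j < card ?R \<Longrightarrow> (\<Sum>i<N. a i * c i (e j)) = 0"
    using nontrivial_kernel[of "card ?R" N "\<lambda>j i. c i (e j)"] \<open>\<not> N \<le> _\<close> card by auto
  have z: "(\<Sum>i<N. a i * c i \<alpha>) = 0" if "\<alpha> \<in> ?R" for \<alpha>
  proof -
    have "\<alpha> \<in> e ` {..<card ?R}" unfolding bij_betw_imp_surj_on[OF e] by (rule that)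
    then show ?thesis using a(2) by blast
  qed
  have "(\<Sum>i<N. a i * F i t) = 0" for t
  proof -
    have "(\<Sum>i<N. a i * F i t) = (\<Sum>i<N. \<Sum>\<alpha>\<in>?R. (a i * c i \<alpha>) * (\<Prod>j\<in>I. t j ^ \<alpha> j))"
      by (intro sum.cong) (auto simp: c sum_distrib_left mult.assoc)
    also have "\<dots> = (\<Sum>\<alpha>\<in>?R. (\<Sum>i<N. a i * c i \<alpha>) * (\<Prod>j\<in>I. t j ^ \<alpha> j))"
      by (subst sum.swap) (simp add: sum_distrib_right)
    also have "\<dots> = 0" using z by simp
    finally show ?thesis .
  qed
  then have "\<forall>t\<in>UNIV. (\<Sum>i<N. a i * F i t) = 0" by (rule ballI)
  then have "\<forall>i<N. a i = 0" by (rule mp[OF spec[OF ind[unfolded indep_funs_def]]])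
  then show False using a(1) by blast
qed

lemma box_poly_compose:
  assumes I: "finite I" and \<phi>: "\<And>i j. i < n \<Longrightarrow> j < n \<Longrightarrow> box_poly I e (\<lambda>t. \<phi> t $$ (i, j))"
    and f: "mat_poly_deg n k f"
  shows "box_poly I (k * e) (\<lambda>t. f (\<phi> t))"
  using f
proof (induction rule: mat_poly_deg.induct)
  case (mult k f l g)
  then show ?case using box_poly_mult[OF I mult.IH] by (simp add: distrib_right)
next
  case (mono k f l)
  then show ?case using box_poly_mono[OF I] by simp
qed (auto intro: box_poly_const[OF I] \<phi> box_poly_add)

text \<open>By \<open>dense\<close>, \<open>X\<close> lies in the Zariski closure of the image of
  \<phi>, so functions independent on \<open>X\<close> remain independent after composition with
  \<phi>. This bounds a quantity of order \<open>K ^ d\<close> by one of order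
  \<open>K ^ card I\<close>.\<close>

lemma growth_ge_param:
  assumes I: "finite I" and \<phi>: "\<And>i j. i < n \<Longrightarrow> j < n \<Longrightarrow> box_poly I e (\<lambda>t. \<phi> t $$ (i, j))"
    and dense: "\<And>f. f \<in> mat_poly_funs n \<Longrightarrow> (\<And>t. f (\<phi> t) = 0) \<Longrightarrow> \<forall>z\<in>X. f z = 0"
    and g: "growth_ge n X d"
  shows "d \<le> card I"
proof (rule ccontr)
  assume "\<not> d \<le> card I"
  then have dI: "card I < d" by simp
  obtain E where E: "\<And>K. hilbert_ge n X (K * E) (K + d choose d)"
    using g unfolding growth_ge_def by blast
  have bound: "(K + d choose d) \<le> Suc (K * E * e) ^ card I" for K
  proof -
    obtain F where F: "\<And>i. i < (K + d choose d) \<Longrightarrow> mat_poly_deg n (K * E) (F i)"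
      "indep_funs X (K + d choose d) F"
      using E[of K] unfolding hilbert_ge_def by blast
    have "indep_funs UNIV (K + d choose d) (\<lambda>i t. F i (\<phi> t))"
      unfolding indep_funs_def
    proof (intro allI impI)
      fix c i assume c: "\<forall>t\<in>UNIV. (\<Sum>i<K + d choose d. c i * F i (\<phi> t)) = 0" and i: "i < (K + d choose d)"
      have "(\<lambda>A. \<Sum>i<K + d choose d. c i * F i A) \<in> mat_poly_funs n"
        by (rule mat_poly_deg_imp_poly[of _ "K * E"])
          (auto intro!: mat_poly_deg_sum mat_poly_deg_scale F)
      from dense[OF this] c have "\<forall>z\<in>X. (\<Sum>i<K + d choose d. c i * F i z) = 0" by simp
      then show "c i = 0" using F(2) i unfolding indep_funs_def by blast
    qed
    then show ?thesis
      by (rule indep_funs_box_poly[OF I]) (auto intro: box_poly_compose[OF I \<phi>] F)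
  qed
  \<comment> \<open>For \<open>K \<ge> 1\<close>, the binomial coefficient is at least
    \<open>(K / d) ^ d\<close>, and \<open>Suc (K * E * e)\<close> is at most
    \<open>K * Suc (E * e)\<close>. If \<open>d\<close> exceeds \<open>card I\<close>, dividing by
    \<open>K ^ card I\<close> leaves \<open>K\<close> bounded by this constant.\<close>
  define C where "C = (Suc (E * e)) ^ card I * d ^ d"
  have "K \<le> C" if "K \<ge> 1" for K
  proof -
    have "(real K / real d) ^ d \<le> (real (K + d) / real d) ^ d"
      by (intro power_mono divide_right_mono) auto
    also have "\<dots> \<le> real (K + d choose d)" by (rule binomial_ge_n_over_k_pow_k) simp
    also have "\<dots> \<le> real (Suc (K * E * e) ^ card I)" using bound[of K] by (simp only: of_nat_le_iff)
    also have "Suc (K * E * e) ^ card I \<le> (K * Suc (E * e)) ^ card I"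
      using that by (intro power_mono) (auto simp: algebra_simps)
    finally have "(real K / real d) ^ d \<le> real ((K * Suc (E * e)) ^ card I)" by simp
    then have "real K ^ d \<le> real ((K * Suc (E * e)) ^ card I) * real d ^ d"
      using dI by (simp add: power_divide divide_le_eq)
    also have "real ((K * Suc (E * e)) ^ card I) * real d ^ d = real (K ^ card I * C)"
      by (simp only: C_def power_mult_distrib of_nat_mult of_nat_power mult.assoc)
    finally have "real (K ^ d) \<le> real (K ^ card I * C)" by simp
    then have "K ^ d \<le> K ^ card I * C" by (simp only: of_nat_le_iff)
    moreover have "K ^ Suc (card I) \<le> K ^ d" using dI that by (intro power_increasing) auto
    moreover have "K ^ Suc (card I) = K ^ card I * K" by (rule power_Suc2)
    ultimately have "K ^ card I * K \<le> K ^ card I * C" by linarith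
    moreover have "K ^ card I > 0" using that by simp
    ultimately show ?thesis by (metis mult_le_cancel1)
  qed
  from this[of "Suc C"] show False by simp
qed

section \<open>Prime sets of matrices\<close>

lemma GL_iff_det: "g \<in> GL n \<longleftrightarrow> g \<in> carrier_mat n n \<and> det g \<noteq> 0"
proof
  assume g: "g \<in> GL n"
  then have c: "g \<in> carrier_mat n n" by (simp add: GL_def)
  interpret vec_space "TYPE(complex)" n .
  have "det g \<noteq> 0"
    using det_rank_iff[OF c] lin_indpt_full_rank[OF c] GL_cols(1,2)[OF g] by simp
  with c show "g \<in> carrier_mat n n \<and> det g \<noteq> 0" by simp
next
  assume g: "g \<in> carrier_mat n n \<and> det g \<noteq> 0"
  then have "g \<in> Units (ring_mat TYPE(complex) n undefined)"
    using det_non_zero_imp_unit[of g n] by simp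
  then have "invertible_mat g"
    using g unfolding Units_def invertible_mat_def inverts_mat_def by (auto simp: ring_mat_def)
  then show "g \<in> GL n" using g by (simp add: GL_def)
qed

lemma GL_mult: "g \<in> GL n \<Longrightarrow> b \<in> carrier_mat n n \<Longrightarrow> g * b \<in> GL n \<longleftrightarrow> b \<in> GL n"
  using det_mult[of g n b] by (auto simp: GL_iff_det)

definition poly_curve :: "nat \<Rightarrow> (complex \<Rightarrow> complex mat) \<Rightarrow> bool" where
  "poly_curve n \<gamma> \<longleftrightarrow> (\<forall>i<n. \<forall>j<n. \<exists>p. \<forall>z. \<gamma> z $$ (i, j) = poly p z)"

lemma mat_poly_curve:
  assumes "f \<in> mat_poly_funs n" "poly_curve n \<gamma>"
  shows "\<exists>p. \<forall>z. f (\<gamma> z) = poly p z"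
  using assms(1)
proof (induction rule: mat_poly_funs.induct)
  case (const c)
  show ?case by (rule exI[of _ "[:c:]"]) simp
next
  case (entry i j)
  then show ?case using assms(2) unfolding poly_curve_def by blast
next
  case (add f g)
  then obtain p r where "\<forall>z. f (\<gamma> z) = poly p z" "\<forall>z. g (\<gamma> z) = poly r z" by blast
  then show ?case by (intro exI[of _ "p + r"]) simp
next
  case (mult f g)
  then obtain p r where "\<forall>z. f (\<gamma> z) = poly p z" "\<forall>z. g (\<gamma> z) = poly r z" by blast
  then show ?case by (intro exI[of _ "p * r"]) simp
qed

lemma finite_zeros_on_curve:
  assumes "f \<in> mat_poly_funs n" "poly_curve n \<gamma>" "f (\<gamma> w) \<noteq> 0"
  shows "finite {z. f (\<gamma> z) = 0}"
proof -
  obtain p where p: "\<And>z. f (\<gamma> z) = poly p z" using mat_poly_curve[OF assms(1,2)] by blast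
  then have "p \<noteq> 0" using assms(3) by auto
  then show ?thesis using p by (simp add: poly_roots_finite)
qed

text \<open>Along a polynomial curve from a point with \<open>f\<close> nonzero to a point with
  \<open>g\<close> nonzero, both functions have only finitely many zeros and the curve leaves
  \<open>Y\<close> only finitely often. The parameter line is infinite, so \<open>f * g\<close> is
  nonzero somewhere on \<open>Y\<close>.\<close>

lemma zariski_primeI:
  assumes "\<And>y y'. y \<in> Y \<Longrightarrow> y' \<in> Y \<Longrightarrow>
    \<exists>\<gamma>. poly_curve n \<gamma> \<and> \<gamma> 0 = y \<and> \<gamma> 1 = y' \<and> finite {z. \<gamma> z \<notin> Y}"
  shows "zariski_prime n Y"
  unfolding zariski_prime_def
proof (intro ballI impI, rule ccontr)
  fix f g assume fg: "f \<in> mat_poly_funs n" "g \<in> mat_poly_funs n" "\<forall>z\<in>Y. f z * g z = 0"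
    and "\<not> ((\<forall>z\<in>Y. f z = 0) \<or> (\<forall>z\<in>Y. g z = 0))"
  then obtain y y' where y: "y \<in> Y" "f y \<noteq> 0" "y' \<in> Y" "g y' \<noteq> 0" by blast
  obtain \<gamma> where \<gamma>: "poly_curve n \<gamma>" "\<gamma> 0 = y" "\<gamma> 1 = y'" "finite {z. \<gamma> z \<notin> Y}"
    using assms[OF y(1,3)] by blast
  let ?B = "{z. f (\<gamma> z) = 0} \<union> {z. g (\<gamma> z) = 0} \<union> {z. \<gamma> z \<notin> Y}"
  have "finite ?B"
    using finite_zeros_on_curve[OF fg(1) \<gamma>(1), of 0] finite_zeros_on_curve[OF fg(2) \<gamma>(1), of 1] \<gamma> y
    by simp
  from ex_new_if_finite[OF infinite_UNIV_char_0 this] obtain z where "z \<notin> ?B" ..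
  then have "\<gamma> z \<in> Y" "f (\<gamma> z) * g (\<gamma> z) \<noteq> 0" by simp_all
  then show False using fg(3) by blast
qed

section \<open>Minors of the first columns (Pluecker coordinates of a flag)\<close>

definition row_minor :: "(nat \<Rightarrow> nat) \<Rightarrow> nat \<Rightarrow> complex mat \<Rightarrow> complex" where
  "row_minor \<rho> k A = det (mat k k (\<lambda>(i, j). A $$ (\<rho> i, j)))"

lemma row_minor_poly:
  assumes "\<And>i. i < k \<Longrightarrow> \<rho> i < n" "k \<le> n"
  shows "row_minor \<rho> k \<in> mat_poly_funs n"
proof -
  have "row_minor \<rho> k = (\<lambda>A. \<Sum>p\<in>{p. p permutes {0..<k}}. signof p * (\<Prod>i=0..<k. A $$ (\<rho> i, p i)))"
  proof
    fix A
    have "row_minor \<rho> k A = (\<Sum>p\<in>{p. p permutes {0..<k}}.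
        signof p * (\<Prod>i=0..<k. mat k k (\<lambda>(i, j). A $$ (\<rho> i, j)) $$ (i, p i)))"
      unfolding row_minor_def by (rule det_def'[OF mat_carrier])
    also have "\<dots> = (\<Sum>p\<in>{p. p permutes {0..<k}}. signof p * (\<Prod>i=0..<k. A $$ (\<rho> i, p i)))"
    proof (rule sum.cong[OF refl])
      fix p assume p: "p \<in> {p. p permutes {0..<k}}"
      have "p i < k" if "i < k" for i using p that permutes_in_image[of p "{0..<k}" i] by auto
      then have "(\<Prod>i=0..<k. mat k k (\<lambda>(i, j). A $$ (\<rho> i, j)) $$ (i, p i)) =
          (\<Prod>i=0..<k. A $$ (\<rho> i, p i))"
        by (intro prod.cong) auto
      then show "signof p * (\<Prod>i=0..<k. mat k k (\<lambda>(i, j). A $$ (\<rho> i, j)) $$ (i, p i)) =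
          signof p * (\<Prod>i=0..<k. A $$ (\<rho> i, p i))" by simp
    qed
    finally show "row_minor \<rho> k A = (\<Sum>p\<in>{p. p permutes {0..<k}}. signof p * (\<Prod>i=0..<k. A $$ (\<rho> i, p i)))" .
  qed
  also have "\<dots> \<in> mat_poly_funs n"
  proof (intro mat_poly_sum mat_poly_funs.mult mat_poly_funs.const mat_poly_prod mat_poly_funs.entry)
    fix p i assume p: "p \<in> {p. p permutes {0..<k}}" and i: "i \<in> {0..<k}"
    then have "p i < k" using permutes_in_image[of p "{0..<k}" i] by auto
    then show "p i < n" "\<rho> i < n" using assms i by auto
  qed
  finally show ?thesis .
qed

lemma row_minor_det: "A \<in> carrier_mat n n \<Longrightarrow> row_minor (\<lambda>i. i) n A = det A"
  unfolding row_minor_def by (rule arg_cong[of _ _ det]) auto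

text \<open>An upper triangular \<open>b\<close> replaces each of the first \<open>k\<close> columns
  by a combination of the first \<open>k\<close> columns, so all these minors acquire a common
  factor. Their vanishing is therefore a property of the flag.\<close>

lemma row_minor_mult_upper_triangular:
  assumes A: "A \<in> carrier_mat n n" and b: "b \<in> carrier_mat n n" "upper_triangular b"
    and \<rho>: "\<And>i. i < k \<Longrightarrow> \<rho> i < n" and k: "k \<le> n"
  shows "row_minor \<rho> k (A * b) = row_minor \<rho> k A * row_minor (\<lambda>i. i) k b"
proof -
  have "mat k k (\<lambda>(i, j). (A * b) $$ (\<rho> i, j)) =
      mat k k (\<lambda>(i, j). A $$ (\<rho> i, j)) * mat k k (\<lambda>(i, j). b $$ (i, j))"
  proof (rule eq_matI)
    fix i j assume "i < dim_row (mat k k (\<lambda>(i, j). A $$ (\<rho> i, j)) * mat k k (\<lambda>(i, j). b $$ (i, j)))"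
      "j < dim_col (mat k k (\<lambda>(i, j). A $$ (\<rho> i, j)) * mat k k (\<lambda>(i, j). b $$ (i, j)))"
    then have ij: "i < k" "j < k" by auto
    have "(A * b) $$ (\<rho> i, j) = (\<Sum>l = 0..<n. A $$ (\<rho> i, l) * b $$ (l, j))"
      using ij \<rho>[of i] k A b by (simp add: scalar_prod_def)
    also have "\<dots> = (\<Sum>l = 0..<k. A $$ (\<rho> i, l) * b $$ (l, j))"
    proof (rule sum.mono_neutral_right)
      have "b $$ (l, j) = 0" if "l < n" "k \<le> l" for l
        using b that ij by (intro upper_triangularD) auto
      then show "\<forall>l\<in>{0..<n} - {0..<k}. A $$ (\<rho> i, l) * b $$ (l, j) = 0" by auto
    qed (use k in auto)
    finally show "mat k k (\<lambda>(i, j). (A * b) $$ (\<rho> i, j)) $$ (i, j) =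
      (mat k k (\<lambda>(i, j). A $$ (\<rho> i, j)) * mat k k (\<lambda>(i, j). b $$ (i, j))) $$ (i, j)"
      using ij by (simp add: scalar_prod_def)
  qed auto
  then show ?thesis unfolding row_minor_def by (simp add: det_mult[of _ k])
qed

text \<open>The determinant along the curve is a polynomial in the parameter that is nonzero at
  \<open>0\<close>, so the curve leaves \<open>GL n\<close> only finitely often.\<close>

lemma zariski_prime_GL:
  assumes "Y \<subseteq> GL n"
    and "\<And>y y'. y \<in> Y \<Longrightarrow> y' \<in> Y \<Longrightarrow>
      \<exists>\<gamma>. poly_curve n \<gamma> \<and> \<gamma> 0 = y \<and> \<gamma> 1 = y' \<and> (\<forall>z. \<gamma> z \<in> carrier_mat n n) \<and>
        (\<forall>z. \<gamma> z \<in> GL n \<longrightarrow> \<gamma> z \<in> Y)"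
  shows "zariski_prime n Y"
proof (rule zariski_primeI)
  fix y y' assume y: "y \<in> Y" "y' \<in> Y"
  then obtain \<gamma> where \<gamma>: "poly_curve n \<gamma>" "\<gamma> 0 = y" "\<gamma> 1 = y'" "\<And>z. \<gamma> z \<in> carrier_mat n n"
      "\<And>z. \<gamma> z \<in> GL n \<Longrightarrow> \<gamma> z \<in> Y"
    using assms(2) by meson
  have "row_minor (\<lambda>i. i) n \<in> mat_poly_funs n" by (rule row_minor_poly) auto
  moreover have "row_minor (\<lambda>i. i) n (\<gamma> 0) \<noteq> 0"
    using y assms(1) row_minor_det[OF \<gamma>(4)] \<gamma>(2) by (auto simp: GL_iff_det)
  ultimately have "finite {z. row_minor (\<lambda>i. i) n (\<gamma> z) = 0}"
    using finite_zeros_on_curve \<gamma>(1) by blast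
  moreover have "{z. \<gamma> z \<notin> Y} \<subseteq> {z. row_minor (\<lambda>i. i) n (\<gamma> z) = 0}"
    using \<gamma>(4,5) row_minor_det[OF \<gamma>(4)] by (auto simp: GL_iff_det)
  ultimately have "finite {z. \<gamma> z \<notin> Y}" by (rule finite_subset[rotated])
  with \<gamma> show "\<exists>\<gamma>. poly_curve n \<gamma> \<and> \<gamma> 0 = y \<and> \<gamma> 1 = y' \<and> finite {z. \<gamma> z \<notin> Y}" by blast
qed

section \<open>Flags and matrices\<close>

definition col_span :: "nat \<Rightarrow> complex mat \<Rightarrow> nat \<Rightarrow> complex vec set" where
  "col_span n g k = {v \<in> carrier_vec n. \<exists>c. \<forall>r<n. v $ r = (\<Sum>j<k. c j * g $$ (r, j))}"

lemma flag_of_eq_col_span: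
  assumes g: "g \<in> carrier_mat n n" and i: "1 \<le> i" "i \<le> n"
  shows "flag_of n g i = col_span n g i"
proof -
  interpret vec_space "TYPE(complex)" n .
  let ?ws = "take i (cols g)"
  have len: "length ?ws = i" using g i by simp
  have ws: "set ?ws \<subseteq> carrier_vec n"
    using g cols_dim set_take_subset by (metis carrier_matD(1) subset_trans)
  have ent: "(mat_of_cols n ?ws *\<^sub>v vec i c) $ r = (\<Sum>j<i. c j * g $$ (r, j))" if "r < n" for r c
    using that len i g by (simp add: scalar_prod_def mat_of_cols_index lessThan_atLeast0 mult.commute)
  have lc: "lincomb_list c ?ws = mat_of_cols n ?ws *\<^sub>v vec i c" for c
    using lincomb_list_as_mat_mult[of ?ws c] ws len by (metis carrier_vecD subsetD)
  have "flag_of n g i = span_list ?ws"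
    using i span_list_as_span[OF ws] by (simp add: flag_of_def)
  also have "\<dots> = col_span n g i"
  proof (intro equalityI subsetI)
    fix v assume "v \<in> span_list ?ws"
    then obtain c where "v = lincomb_list c ?ws" by (auto elim: in_span_listE)
    then have v: "v = mat_of_cols n ?ws *\<^sub>v vec i c" using lc by simp
    have "v \<in> carrier_vec n"
      unfolding v by (intro mult_mat_vec_carrier[OF mat_of_cols_carrier(1)]) (simp only: len vec_carrier)
    moreover have "\<forall>r<n. v $ r = (\<Sum>j<i. c j * g $$ (r, j))"
      unfolding v using ent by (intro allI impI)
    ultimately show "v \<in> col_span n g i" unfolding col_span_def by blast
  next
    fix v assume "v \<in> col_span n g i"
    then obtain c where v: "v \<in> carrier_vec n" "\<forall>r<n. v $ r = (\<Sum>j<i. c j * g $$ (r, j))"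
      unfolding col_span_def by blast
    then have "v = lincomb_list c ?ws"
      unfolding lc using ent by (intro eq_vecI) auto
    then show "v \<in> span_list ?ws" by (intro in_span_listI) auto
  qed
  finally show ?thesis .
qed

text \<open>Both members have dimension \<open>i\<close>, so an inclusion is already an
  equality.\<close>

lemma flag_of_eqI:
  assumes g: "g \<in> GL n" and h: "h \<in> GL n" and sub: "\<And>i. 1 \<le> i \<Longrightarrow> i \<le> n \<Longrightarrow> flag_of n h i \<subseteq> flag_of n g i"
  shows "flag_of n h = flag_of n g"
proof
  fix i
  interpret vec_space "TYPE(complex)" n .
  show "flag_of n h i = flag_of n g i"
  proof (cases "1 \<le> i \<and> i \<le> n")
    case True
    let ?S = "set (take i (cols h))"
    note c = GL_cols[OF h]
    have S: "?S \<subseteq> carrier_vec n" using c(3) set_take_subset by fast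
    have hs: "flag_of n h i = span ?S" using True by (simp add: flag_of_def)
    have W: "subspace_of_dim n i (flag_of n g i)"
      using flag_of_in_flags[OF g] True by (simp add: flags_def)
    have "span ?S = flag_of n g i"
    proof (rule span_eq_subspace)
      show "VectorSpace.subspace class_ring (flag_of n g i) V"
        using W by (simp add: subspace_of_dim_def)
      show "?S \<subseteq> flag_of n g i" using in_own_span[OF S] hs sub True by auto
      show "lin_indpt ?S" using subset_li_is_li[OF c(2) set_take_subset] .
      show "card ?S = vectorspace.dim class_ring (vs (flag_of n g i))"
        using W c(1,4) True by (simp add: subspace_of_dim_def distinct_card)
    qed simp
    then show ?thesis using hs by simp
  next
    case False
    then show ?thesis by (auto simp: flag_of_def)
  qed
qed

text \<open>This identifies the fibres of \<open>flag_of\<close> with the cosets of the Borel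
  subgroup; \<open>b\<close> is invertible because \<open>g\<close> and \<open>g * b\<close>
  are.\<close>

lemma flag_of_eq_iff:
  assumes g: "g \<in> GL n" and h: "h \<in> GL n"
  shows "flag_of n h = flag_of n g \<longleftrightarrow>
    (\<exists>b\<in>carrier_mat n n. upper_triangular b \<and> h = g * b)"
proof
  have gc: "g \<in> carrier_mat n n" and hc: "h \<in> carrier_mat n n" using g h by (auto simp: GL_def)
  {
    assume eq: "flag_of n h = flag_of n g"
    have "\<exists>c. \<forall>r<n. h $$ (r, j) = (\<Sum>k<Suc j. c k * g $$ (r, k))" if j: "j < n" for j
    proof -
      have "(\<Sum>k<Suc j. (if k = j then 1 else 0) * h $$ (r, k)) = h $$ (r, j)" for r
        by (simp add: if_distrib[of "\<lambda>x. x * _"] cong: if_cong)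
      then have "col h j \<in> col_span n h (Suc j)"
        using j hc unfolding col_span_def by (auto intro!: exI[of _ "\<lambda>k. if k = j then 1 else 0"])
      then have "col h j \<in> col_span n g (Suc j)"
        using eq flag_of_eq_col_span[OF gc] flag_of_eq_col_span[OF hc] j by simp
      then show ?thesis using j hc unfolding col_span_def by auto
    qed
    then obtain c where c: "\<And>j r. j < n \<Longrightarrow> r < n \<Longrightarrow> h $$ (r, j) = (\<Sum>k<Suc j. c j k * g $$ (r, k))"
      by metis
    \<comment> \<open>Column \<open>j\<close> of \<open>h\<close> lies in the span of columns
      \<open>0, ..., j\<close> of \<open>g\<close>; its coefficients, padded by zeros, form column
      \<open>j\<close> of \<open>b\<close>.\<close>
    define b where "b = mat n n (\<lambda>(k, j). if k \<le> j then c j k else 0)"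
    have "h = g * b"
    proof (rule eq_matI)
      fix r j assume "r < dim_row (g * b)" "j < dim_col (g * b)"
      then have rj: "r < n" "j < n" using gc by (auto simp: b_def)
      have "(g * b) $$ (r, j) = (\<Sum>k<n. g $$ (r, k) * (if k \<le> j then c j k else 0))"
        using rj gc by (simp add: b_def scalar_prod_def lessThan_atLeast0)
      also have "\<dots> = (\<Sum>k<Suc j. g $$ (r, k) * (if k \<le> j then c j k else 0))"
        using rj by (intro sum.mono_neutral_right) auto
      also have "\<dots> = h $$ (r, j)" using c[OF rj(2,1)] by (auto intro!: sum.cong)
      finally show "h $$ (r, j) = (g * b) $$ (r, j)" by simp
    qed (use gc hc in \<open>auto simp: b_def\<close>)
    moreover have "upper_triangular b" "b \<in> carrier_mat n n" by (auto simp: b_def)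
    ultimately show "\<exists>b\<in>carrier_mat n n. upper_triangular b \<and> h = g * b" by blast
  }
  assume "\<exists>b\<in>carrier_mat n n. upper_triangular b \<and> h = g * b"
  then obtain b where b: "b \<in> carrier_mat n n" "upper_triangular b" "h = g * b" by blast
  show "flag_of n h = flag_of n g"
  proof (rule flag_of_eqI[OF g h])
    fix i assume i: "1 \<le> i" "i \<le> n"
    have "col_span n h i \<subseteq> col_span n g i"
    proof
      fix v assume "v \<in> col_span n h i"
      then obtain c where v: "v \<in> carrier_vec n" "\<And>r. r < n \<Longrightarrow> v $ r = (\<Sum>j<i. c j * h $$ (r, j))"
        unfolding col_span_def by blast
      have "v $ r = (\<Sum>k<i. (\<Sum>j<i. c j * b $$ (k, j)) * g $$ (r, k))" if r: "r < n" for r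
      proof -
        have "h $$ (r, j) = (\<Sum>k<i. b $$ (k, j) * g $$ (r, k))" if "j < i" for j
        proof -
          have "h $$ (r, j) = (\<Sum>k<n. b $$ (k, j) * g $$ (r, k))"
            using r that i b gc by (simp add: scalar_prod_def lessThan_atLeast0 mult.commute)
          also have "\<dots> = (\<Sum>k<i. b $$ (k, j) * g $$ (r, k))"
          proof (rule sum.mono_neutral_right)
            show "\<forall>k\<in>{..<n} - {..<i}. b $$ (k, j) * g $$ (r, k) = 0"
              using b(1) that by (auto intro: upper_triangularD[OF b(2)])
          qed (use i in auto)
          finally show ?thesis .
        qed
        then have "v $ r = (\<Sum>j<i. \<Sum>k<i. c j * (b $$ (k, j) * g $$ (r, k)))"
          using v(2)[OF r] by (simp add: sum_distrib_left)
        also have "\<dots> = (\<Sum>k<i. (\<Sum>j<i. c j * b $$ (k, j)) * g $$ (r, k))"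
          by (subst sum.swap) (simp add: sum_distrib_right mult.assoc)
        finally show ?thesis .
      qed
      then show "v \<in> col_span n g i"
        using v(1) unfolding col_span_def
        by (intro CollectI conjI exI[of _ "\<lambda>k. \<Sum>j<i. c j * b $$ (k, j)"]) simp_all
    qed
    then show "flag_of n h i \<subseteq> flag_of n g i"
      using flag_of_eq_col_span[OF gc] flag_of_eq_col_span[OF hc] i by simp
  qed
qed

section \<open>Closed sets of flags and the primality of their preimages\<close>

lemma topspace_flag_variety [simp]: "topspace (flag_variety n) = flags n"
proof -
  have "topspace (flag_variety n) = flag_of n ` GL n"
    using quotient_imp_surjective_map[OF quotient_map_flag_of] by simp
  also have "\<dots> = flags n"
  proof
    show "flag_of n ` GL n \<subseteq> flags n" using flag_of_in_flags by blast
    show "flags n \<subseteq> flag_of n ` GL n" using flag_of_surj by (metis image_eqI subsetI)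
  qed
  finally show ?thesis .
qed

text \<open>Continuity of the quotient map turns a closed set of flags into polynomial equations on
  \<open>GL n\<close>. These equations later separate consecutive members of a chain.\<close>

lemma closedin_flag_variety_preimage:
  assumes "closedin (flag_variety n) Z"
  obtains S where "S \<subseteq> mat_poly_funs n"
    "\<And>g. g \<in> GL n \<Longrightarrow> flag_of n g \<in> Z \<longleftrightarrow> (\<forall>f\<in>S. f g = 0)"
proof -
  have "closedin (zariski_GL n) {g \<in> topspace (zariski_GL n). flag_of n g \<in> Z}"
    using quotient_imp_continuous_map[OF quotient_map_flag_of] assms
    by (rule closedin_continuous_map_preimage)
  then obtain T where T: "closedin (zariski_mat n) T" "{g \<in> GL n. flag_of n g \<in> Z} = T \<inter> GL n"
    unfolding zariski_GL_def closedin_subtopology by (auto simp: GL_def)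
  then obtain S where "S \<subseteq> mat_poly_funs n" "T = mat_zeros n S"
    unfolding closedin_zariski_mat by blast
  with T(2) show thesis
    by (intro that[of S]) (auto simp: mat_zeros_def GL_def set_eq_iff)
qed

lemma mat_poly_mult_right:
  assumes "f \<in> mat_poly_funs n" "b \<in> carrier_mat n n"
  shows "\<exists>f'\<in>mat_poly_funs n. \<forall>A\<in>carrier_mat n n. f' A = f (A * b)"
  using assms(1)
proof (induction rule: mat_poly_funs.induct)
  case (const c)
  show ?case by (rule bexI[of _ "\<lambda>_. c"]) (auto intro: mat_poly_funs.const)
next
  case (entry i j)
  have "(\<lambda>A. \<Sum>k<n. A $$ (i, k) * b $$ (k, j)) \<in> mat_poly_funs n"
    using entry by (auto intro!: mat_poly_sum mat_poly_funs.intros)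
  moreover have "(\<Sum>k<n. A $$ (i, k) * b $$ (k, j)) = (A * b) $$ (i, j)"
    if "A \<in> carrier_mat n n" for A
    using entry that assms(2) by (simp add: scalar_prod_def lessThan_atLeast0)
  ultimately show ?case by (intro bexI[of _ "\<lambda>A. \<Sum>k<n. A $$ (i, k) * b $$ (k, j)"]) auto
next
  case (add f g)
  then obtain f' g' where "f' \<in> mat_poly_funs n" "\<forall>A\<in>carrier_mat n n. f' A = f (A * b)"
    "g' \<in> mat_poly_funs n" "\<forall>A\<in>carrier_mat n n. g' A = g (A * b)" by blast
  then show ?case by (intro bexI[of _ "\<lambda>A. f' A + g' A"]) (auto intro: mat_poly_funs.add)
next
  case (mult f g)
  then obtain f' g' where "f' \<in> mat_poly_funs n" "\<forall>A\<in>carrier_mat n n. f' A = f (A * b)"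
    "g' \<in> mat_poly_funs n" "\<forall>A\<in>carrier_mat n n. g' A = g (A * b)" by blast
  then show ?case by (intro bexI[of _ "\<lambda>A. f' A * g' A"]) (auto intro: mat_poly_funs.mult)
qed

lemma openin_zariski_GL_nonzero:
  assumes "f \<in> mat_poly_funs n"
  shows "openin (zariski_GL n) {g \<in> GL n. f g \<noteq> 0}"
proof -
  have "openin (zariski_mat n) (carrier_mat n n - mat_zeros n {f})"
    unfolding openin_zariski_mat using assms by blast
  moreover have "{g \<in> GL n. f g \<noteq> 0} = (carrier_mat n n - mat_zeros n {f}) \<inter> GL n"
    by (auto simp: mat_zeros_def GL_def)
  ultimately show ?thesis unfolding zariski_GL_def openin_subtopology by blast
qed

text \<open>As \<open>f\<close> is not a function on flags, its vanishing is imposed on the whole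
  fibre. The complement pulls back to the union, over the Borel subgroup, of the translates of the
  set where \<open>f\<close> is nonzero, hence to an open set.\<close>

lemma closedin_flags_vanishing:
  assumes f: "f \<in> mat_poly_funs n"
  shows "closedin (flag_variety n) {V \<in> flags n. \<forall>g\<in>GL n. flag_of n g = V \<longrightarrow> f g = 0}"
    (is "closedin _ ?A")
proof -
  let ?B = "{b \<in> GL n. upper_triangular b}"
  have mult: "g * b \<in> GL n" if "g \<in> GL n" "b \<in> GL n" for g b
    using that GL_mult[of g n b] by (simp add: GL_def)
  have "{g \<in> GL n. flag_of n g \<in> flags n - ?A} = (\<Union>b\<in>?B. {g \<in> GL n. f (g * b) \<noteq> 0})"
  proof (intro equalityI subsetI)
    fix g assume "g \<in> {g \<in> GL n. flag_of n g \<in> flags n - ?A}"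
    then obtain h where h: "g \<in> GL n" "h \<in> GL n" "flag_of n h = flag_of n g" "f h \<noteq> 0" by blast
    then obtain b where b: "b \<in> carrier_mat n n" "upper_triangular b" "h = g * b"
      using flag_of_eq_iff by blast
    moreover have "b \<in> GL n" using h(1,2) b GL_mult[OF h(1) b(1)] by simp
    ultimately show "g \<in> (\<Union>b\<in>?B. {g \<in> GL n. f (g * b) \<noteq> 0})" using h by auto
  next
    fix g assume "g \<in> (\<Union>b\<in>?B. {g \<in> GL n. f (g * b) \<noteq> 0})"
    then obtain b where b: "b \<in> GL n" "upper_triangular b" "g \<in> GL n" "f (g * b) \<noteq> 0" by blast
    then have "flag_of n (g * b) = flag_of n g"
      using flag_of_eq_iff[OF b(3) mult[OF b(3,1)]] by (auto simp: GL_def)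
    then show "g \<in> {g \<in> GL n. flag_of n g \<in> flags n - ?A}"
      using b mult[OF b(3,1)] flag_of_in_flags by auto
  qed
  also have "openin (zariski_GL n) \<dots>"
  proof (rule openin_Union, safe)
    fix b assume b: "b \<in> GL n"
    then obtain f' where f': "f' \<in> mat_poly_funs n" "\<forall>A\<in>carrier_mat n n. f' A = f (A * b)"
      using mat_poly_mult_right[OF f] by (auto simp: GL_def)
    then have "{g \<in> GL n. f (g * b) \<noteq> 0} = {g \<in> GL n. f' g \<noteq> 0}" by (auto simp: GL_def)
    then show "openin (zariski_GL n) {g \<in> GL n. f (g * b) \<noteq> 0}"
      using openin_zariski_GL_nonzero[OF f'(1)] by simp
  qed
  finally have "openin (flag_variety n) (flags n - ?A)" unfolding openin_flag_variety by blast
  then show ?thesis unfolding closedin_def by auto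
qed

text \<open>Positions in \<open>S\<close> are pairs (column, row).\<close>

definition coset_part :: "nat \<Rightarrow> complex mat \<Rightarrow> (nat \<times> nat) set \<Rightarrow> complex mat set" where
  "coset_part n g S = {g * b | b. b \<in> GL n \<and>
     (\<forall>i<n. \<forall>j<n. (j, i) \<notin> S \<longrightarrow> b $$ (i, j) = (if i = j then 1 else 0))}"

lemma poly_curve_segment:
  assumes "g \<in> carrier_mat n n" "b \<in> carrier_mat n n" "b' \<in> carrier_mat n n"
  shows "poly_curve n (\<lambda>z. g * ((1 - z) \<cdot>\<^sub>m b + z \<cdot>\<^sub>m b'))"
  unfolding poly_curve_def
proof (intro allI impI)
  fix i j assume ij: "i < n" "j < n"
  have "(g * ((1 - z) \<cdot>\<^sub>m b + z \<cdot>\<^sub>m b')) $$ (i, j) =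
      (1 - z) * (g * b) $$ (i, j) + z * (g * b') $$ (i, j)" for z
    using ij assms
    by (simp add: scalar_prod_def sum.distrib sum_distrib_left algebra_simps sum_subtractf)
  then show "\<exists>p. \<forall>z. (g * ((1 - z) \<cdot>\<^sub>m b + z \<cdot>\<^sub>m b')) $$ (i, j) = poly p z"
    by (intro exI[of _ "[:(g * b) $$ (i, j), (g * b') $$ (i, j) - (g * b) $$ (i, j):]"])
      (simp add: algebra_simps)
qed

text \<open>The conditions on the entries of \<open>b\<close> are affine linear and thus hold along
  the segment joining two solutions; left multiplication by \<open>g\<close> makes this a polynomial
  curve in the matrices.\<close>

lemma zariski_prime_coset_part:
  assumes g: "g \<in> GL n"
  shows "zariski_prime n (coset_part n g S)"
proof (rule zariski_prime_GL)
  have gc: "g \<in> carrier_mat n n" using g by (simp add: GL_def)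
  show "coset_part n g S \<subseteq> GL n"
  proof
    fix y assume "y \<in> coset_part n g S"
    then obtain b where "b \<in> GL n" "y = g * b" unfolding coset_part_def by blast
    then show "y \<in> GL n" using GL_mult[OF g, of b] by (simp add: GL_def)
  qed
  let ?P = "\<lambda>b. \<forall>i<n. \<forall>j<n. (j, i) \<notin> S \<longrightarrow> b $$ (i, j) = (if i = j then 1 else 0 :: complex)"
  fix y y' assume "y \<in> coset_part n g S" "y' \<in> coset_part n g S"
  then obtain b b' where b: "b \<in> GL n" "?P b" "y = g * b" and b': "b' \<in> GL n" "?P b'" "y' = g * b'"
    unfolding coset_part_def by blast
  then have c: "b \<in> carrier_mat n n" "b' \<in> carrier_mat n n" by (auto simp: GL_def)
  define u where "u z = (1 - z) \<cdot>\<^sub>m b + z \<cdot>\<^sub>m b'" for z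
  have u: "u z \<in> carrier_mat n n" for z using c by (simp add: u_def)
  have P: "?P (u z)" for z
  proof (intro allI impI)
    fix i j assume "i < n" "j < n" "(j, i) \<notin> S"
    then show "u z $$ (i, j) = (if i = j then 1 else 0)" using b(2) b'(2) c by (simp add: u_def)
  qed
  have "g * u z \<in> coset_part n g S" if "g * u z \<in> GL n" for z
    using that GL_mult[OF g u] P unfolding coset_part_def by blast
  moreover have "u 0 = b" "u 1 = b'" using c by (auto simp: u_def)
  moreover have "poly_curve n (\<lambda>z. g * u z)" unfolding u_def by (rule poly_curve_segment[OF gc c])
  ultimately show "\<exists>\<gamma>. poly_curve n \<gamma> \<and> \<gamma> 0 = y \<and> \<gamma> 1 = y' \<and> (\<forall>z. \<gamma> z \<in> carrier_mat n n) \<and>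
        (\<forall>z. \<gamma> z \<in> GL n \<longrightarrow> \<gamma> z \<in> coset_part n g S)"
    using b b' gc u by (intro exI[of _ "\<lambda>z. g * u z"]) auto
qed

lemma fibre_eq_coset_part:
  assumes g: "g \<in> GL n"
  shows "{h \<in> GL n. flag_of n h = flag_of n g} = coset_part n g (SIGMA j:{..<n}. {..j})"
proof (intro equalityI subsetI)
  have upper: "upper_triangular b \<longleftrightarrow>
      (\<forall>i<n. \<forall>j<n. (j, i) \<notin> (SIGMA j:{..<n}. {..j}) \<longrightarrow> b $$ (i, j) = (if i = j then 1 else 0))"
    if "b \<in> carrier_mat n n" for b :: "complex mat"
    using that unfolding upper_triangular_def by auto
  fix y
  {
    assume "y \<in> {h \<in> GL n. flag_of n h = flag_of n g}"
    then obtain b where b: "b \<in> carrier_mat n n" "upper_triangular b" "y = g * b" "y \<in> GL n"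
      using flag_of_eq_iff[OF g] by auto
    then show "y \<in> coset_part n g (SIGMA j:{..<n}. {..j})"
      using GL_mult[OF g b(1)] upper[OF b(1)] unfolding coset_part_def by blast
  }
  assume "y \<in> coset_part n g (SIGMA j:{..<n}. {..j})"
  then obtain b where b: "b \<in> GL n" "y = g * b"
    "\<forall>i<n. \<forall>j<n. (j, i) \<notin> (SIGMA j:{..<n}. {..j}) \<longrightarrow> b $$ (i, j) = (if i = j then 1 else 0)"
    unfolding coset_part_def by blast
  then have bc: "b \<in> carrier_mat n n" by (simp add: GL_def)
  have "y \<in> GL n" using GL_mult[OF g bc] b by simp
  then show "y \<in> {h \<in> GL n. flag_of n h = flag_of n g}"
    using flag_of_eq_iff[OF g, of y] upper[OF bc] b(2,3) bc by blast
qed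

lemma zariski_prime_fibre:
  "g \<in> GL n \<Longrightarrow> zariski_prime n {h \<in> GL n. flag_of n h = flag_of n g}"
  by (simp only: fibre_eq_coset_part zariski_prime_coset_part)

text \<open>The fibres of \<open>flag_of\<close> are prime, so that each of them lies in one of two closed sets
  covering the preimage of \<open>Z\<close>.\<close>

lemma zariski_prime_preimage:
  assumes Z: "Z \<subseteq> flags n" and irr: "irreducible_space (subtopology (flag_variety n) Z)"
  shows "zariski_prime n {g \<in> GL n. flag_of n g \<in> Z}"
  unfolding zariski_prime_def
proof (intro ballI impI)
  fix f g assume f: "f \<in> mat_poly_funs n" and g: "g \<in> mat_poly_funs n"
    and fg: "\<forall>y\<in>{g \<in> GL n. flag_of n g \<in> Z}. f y * g y = 0"
  define A where "A f = {V \<in> flags n. \<forall>g\<in>GL n. flag_of n g = V \<longrightarrow> f g = 0}" for f :: "complex mat \<Rightarrow> complex"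
  have top: "topspace (subtopology (flag_variety n) Z) = Z" using Z by auto
  have "closedin (subtopology (flag_variety n) Z) (A f \<inter> Z)"
    "closedin (subtopology (flag_variety n) Z) (A g \<inter> Z)"
    using closedin_flags_vanishing[OF f] closedin_flags_vanishing[OF g]
    unfolding A_def closedin_subtopology by blast+
  moreover have "Z = (A f \<inter> Z) \<union> (A g \<inter> Z)"
  proof -
    have "V \<in> A f \<or> V \<in> A g" if V: "V \<in> Z" for V
    proof -
      obtain h where h: "h \<in> GL n" "flag_of n h = V" using flag_of_surj V Z by blast
      have "\<forall>y\<in>{y \<in> GL n. flag_of n y = flag_of n h}. f y * g y = 0" using fg V h by auto
      then have "(\<forall>y\<in>{y \<in> GL n. flag_of n y = flag_of n h}. f y = 0) \<or>
          (\<forall>y\<in>{y \<in> GL n. flag_of n y = flag_of n h}. g y = 0)"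
        using zariski_prime_fibre[OF h(1)] f g unfolding zariski_prime_def by blast
      then show ?thesis using V h Z unfolding A_def by auto
    qed
    then show ?thesis by blast
  qed
  ultimately have "A f \<inter> Z = Z \<or> A g \<inter> Z = Z"
    using irr unfolding irreducible_space_def top by blast
  then show "(\<forall>y\<in>{g \<in> GL n. flag_of n g \<in> Z}. f y = 0) \<or> (\<forall>y\<in>{g \<in> GL n. flag_of n g \<in> Z}. g y = 0)"
    unfolding A_def by blast
qed

text \<open>A proper closed subset of the closure misses a flag of \<open>Y\<close>, so one of its
  equations is not identically zero on \<open>Y\<close>. Two such subsets covering the closure would
  yield equations whose product vanishes on \<open>Y\<close>, against primality.\<close>

lemma irreducible_closure_of_prime:
  assumes H: "H \<subseteq> flags n" and Y: "Y \<subseteq> GL n" "flag_of n ` Y \<subseteq> H" "Y \<noteq> {}" "zariski_prime n Y"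
  defines "T \<equiv> subtopology (flag_variety n) H"
  shows "irreducible_space (subtopology T (T closure_of (flag_of n ` Y)))"
proof -
  let ?S = "flag_of n ` Y" and ?C = "T closure_of (flag_of n ` Y)"
  have tT: "topspace T = H" using H unfolding T_def by auto
  have SC: "?S \<subseteq> ?C" using Y(2) tT by (simp add: closure_of_subset)
  have CH: "?C \<subseteq> H" using closure_of_subset_topspace[of T] tT by blast
  have top: "topspace (subtopology T ?C) = ?C" using CH tT by auto
  show ?thesis unfolding irreducible_space_def top
  proof (intro conjI allI impI)
    show "?C \<noteq> {}" using SC Y(3) by auto
    fix A B assume AB: "closedin (subtopology T ?C) A \<and> closedin (subtopology T ?C) B \<and> ?C = A \<union> B"
    have cl: "closedin T A" "closedin T B"
      using AB closedin_trans_full closedin_closure_of by blast+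
    have ex: "\<exists>f\<in>mat_poly_funs n. (\<forall>g\<in>Y. flag_of n g \<in> D \<longrightarrow> f g = 0) \<and> (\<exists>g\<in>Y. f g \<noteq> 0)"
      if D: "closedin T D" "D \<subseteq> ?C" "D \<noteq> ?C" for D
    proof -
      have "\<not> ?S \<subseteq> D" using D closure_of_minimal[of ?S D T] by blast
      then obtain y where y: "y \<in> Y" "flag_of n y \<notin> D" by blast
      obtain D' where D': "closedin (flag_variety n) D'" "D = D' \<inter> H"
        using D(1) unfolding T_def closedin_subtopology by blast
      obtain S where S: "S \<subseteq> mat_poly_funs n" "\<And>g. g \<in> GL n \<Longrightarrow> flag_of n g \<in> D' \<longleftrightarrow> (\<forall>f\<in>S. f g = 0)"
        by (rule closedin_flag_variety_preimage[OF D'(1)]) (rule that)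
      have "flag_of n y \<notin> D'" using y D' Y(2) by blast
      then obtain f where f: "f \<in> S" "f y \<noteq> 0" using S(2)[of y] y Y(1) by blast
      moreover have "f g = 0" if "g \<in> Y" "flag_of n g \<in> D" for g
        using S(2)[of g] that Y(1) D'(2) f(1) by blast
      ultimately show ?thesis using S(1) y(1) by blast
    qed
    show "A = ?C \<or> B = ?C"
    proof (rule ccontr)
      assume "\<not> (A = ?C \<or> B = ?C)"
      then obtain f g where f: "f \<in> mat_poly_funs n" "\<forall>y\<in>Y. flag_of n y \<in> A \<longrightarrow> f y = 0" "\<exists>y\<in>Y. f y \<noteq> 0"
        and g: "g \<in> mat_poly_funs n" "\<forall>y\<in>Y. flag_of n y \<in> B \<longrightarrow> g y = 0" "\<exists>y\<in>Y. g y \<noteq> 0"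
        using ex[of A] ex[of B] cl AB by blast
      have "\<forall>y\<in>Y. f y * g y = 0" using f(2) g(2) SC AB by fastforce
      then show False using Y(4) f g unfolding zariski_prime_def by blast
    qed
  qed
qed

section \<open>Linear algebra of columns and minors\<close>

text \<open>The coordinate form of \<open>col_span\<close>: vectors are functions of which only the
  values below \<open>n\<close> count, so that projections and combinations can be written
  entrywise.\<close>

definition in_cols :: "nat \<Rightarrow> complex mat \<Rightarrow> nat \<Rightarrow> (nat \<Rightarrow> complex) \<Rightarrow> bool" where
  "in_cols n g k y \<longleftrightarrow> (\<exists>c. \<forall>r<n. y r = (\<Sum>j<k. c j * g $$ (r, j)))"

lemma mem_col_span_iff: "v \<in> col_span n g k \<longleftrightarrow> v \<in> carrier_vec n \<and> in_cols n g k (\<lambda>r. v $ r)"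
  by (simp add: col_span_def in_cols_def)

lemma in_cols_cong: "in_cols n g k y \<Longrightarrow> (\<And>r. r < n \<Longrightarrow> y r = y' r) \<Longrightarrow> in_cols n g k y'"
  by (simp add: in_cols_def)

lemma in_cols_add:
  assumes "in_cols n g k y" "in_cols n g k z"
  shows "in_cols n g k (\<lambda>r. y r + z r)"
proof -
  obtain c d where "\<forall>r<n. y r = (\<Sum>j<k. c j * g $$ (r, j))" "\<forall>r<n. z r = (\<Sum>j<k. d j * g $$ (r, j))"
    using assms unfolding in_cols_def by blast
  then show ?thesis unfolding in_cols_def
    by (intro exI[of _ "\<lambda>j. c j + d j"]) (simp add: distrib_right sum.distrib)
qed

lemma in_cols_scale:
  assumes "in_cols n g k y"
  shows "in_cols n g k (\<lambda>r. a * y r)"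
proof -
  obtain c where "\<forall>r<n. y r = (\<Sum>j<k. c j * g $$ (r, j))"
    using assms unfolding in_cols_def by blast
  then show ?thesis unfolding in_cols_def
    by (intro exI[of _ "\<lambda>j. a * c j"]) (simp add: sum_distrib_left mult.assoc)
qed

lemma in_cols_zero: "in_cols n g k (\<lambda>r. 0)"
  unfolding in_cols_def by (intro exI[of _ "\<lambda>_. 0"]) simp

lemma in_cols_sum:
  assumes "\<And>s. s \<in> S \<Longrightarrow> in_cols n g k (y s)"
  shows "in_cols n g k (\<lambda>r. \<Sum>s\<in>S. y s r)"
  using assms by (induction S rule: infinite_finite_induct) (auto intro: in_cols_zero in_cols_add)

lemma in_cols_mono:
  assumes "in_cols n g k y" "k \<le> l"
  shows "in_cols n g l y"
proof -
  obtain c where c: "\<forall>r<n. y r = (\<Sum>j<k. c j * g $$ (r, j))"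
    using assms unfolding in_cols_def by blast
  have "(\<Sum>j<l. (if j < k then c j else 0) * g $$ (r, j)) = (\<Sum>j<k. c j * g $$ (r, j))" for r
    using assms(2) by (intro sum.mono_neutral_cong_right) auto
  with c show ?thesis unfolding in_cols_def
    by (intro exI[of _ "\<lambda>j. if j < k then c j else 0"]) simp
qed

lemma in_cols_col:
  assumes "j < k"
  shows "in_cols n g k (\<lambda>r. g $$ (r, j))"
proof -
  have "(\<Sum>i<k. (if i = j then 1 else 0) * g $$ (r, i)) = g $$ (r, j)" for r
    using assms by (simp add: if_distrib[of "\<lambda>x. x * _"] cong: if_cong)
  then show ?thesis unfolding in_cols_def
    by (intro exI[of _ "\<lambda>i. if i = j then 1 else 0"]) simp
qed

lemma row_minor_kernel:
  assumes "row_minor \<rho> k g \<noteq> 0" "\<And>r. r < k \<Longrightarrow> (\<Sum>l<k. c l * g $$ (\<rho> r, l)) = 0" "l < k"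
  shows "c l = 0"
proof -
  let ?M = "mat k k (\<lambda>(i, j). g $$ (\<rho> i, j))"
  have "?M *\<^sub>v vec k c = 0\<^sub>v k"
  proof (rule eq_vecI)
    fix r assume "r < dim_vec (0\<^sub>v k :: complex vec)"
    then show "(?M *\<^sub>v vec k c) $ r = 0\<^sub>v k $ r"
      using assms(2)[of r] by (simp add: scalar_prod_def lessThan_atLeast0 mult.commute)
  qed simp
  then have "vec k c = 0\<^sub>v k"
    using assms(1) det_0_iff_vec_prod_zero[of ?M k] unfolding row_minor_def
    by (metis mat_carrier vec_carrier)
  then have "vec k c $ l = 0\<^sub>v k $ l" by (rule arg_cong)
  then show ?thesis using assms(3) by simp
qed

lemma row_minor_solve:
  assumes "row_minor \<rho> k g \<noteq> 0"
  shows "\<exists>c. \<forall>r<k. y r = (\<Sum>l<k. c l * g $$ (\<rho> r, l))"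
proof -
  let ?M = "mat k k (\<lambda>(i, j). g $$ (\<rho> i, j))"
  have M: "?M \<in> carrier_mat k k" by simp
  have d: "det ?M \<noteq> 0" using assms by (simp add: row_minor_def)
  \<comment> \<open>Cramer's rule in adjugate form: \<open>?M * adj_mat ?M\<close> is
    \<open>det ?M\<close> times the identity.\<close>
  let ?c = "(1 / det ?M) \<cdot>\<^sub>v (adj_mat ?M *\<^sub>v vec k y)"
  note adj = adj_mat[OF M]
  have "?M *\<^sub>v ?c = (1 / det ?M) \<cdot>\<^sub>v (?M *\<^sub>v (adj_mat ?M *\<^sub>v vec k y))"
    by (rule mult_mat_vec[OF M]) (rule mult_mat_vec_carrier[OF adj(1) vec_carrier])
  also have "?M *\<^sub>v (adj_mat ?M *\<^sub>v vec k y) = (?M * adj_mat ?M) *\<^sub>v vec k y"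
    by (rule assoc_mult_mat_vec[OF M adj(1) vec_carrier, symmetric])
  also have "\<dots> = (det ?M \<cdot>\<^sub>m 1\<^sub>m k) *\<^sub>v vec k y" by (simp only: adj(2))
  finally have eq: "?M *\<^sub>v ?c = (1 / det ?M) \<cdot>\<^sub>v ((det ?M \<cdot>\<^sub>m 1\<^sub>m k) *\<^sub>v vec k y)" .
  have dc: "dim_vec ?c = k" using adj(1) by simp
  have "y r = (\<Sum>l<k. ?c $ l * g $$ (\<rho> r, l))" if r: "r < k" for r
  proof -
    have "(\<Sum>l<k. ?c $ l * g $$ (\<rho> r, l)) = row ?M r \<bullet> ?c"
      unfolding scalar_prod_def dc lessThan_atLeast0 using r by (intro sum.cong) simp_all
    also have "\<dots> = (?M *\<^sub>v ?c) $ r" using r by (intro index_mult_mat_vec[symmetric]) simp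
    also have "\<dots> = (1 / det ?M) * (row (det ?M \<cdot>\<^sub>m 1\<^sub>m k) r \<bullet> vec k y)"
      unfolding eq using r by simp
    also have "row (det ?M \<cdot>\<^sub>m 1\<^sub>m k) r \<bullet> vec k y = det ?M * y r"
    proof -
      have "row (e \<cdot>\<^sub>m 1\<^sub>m k) r \<bullet> vec k y = e * y r" for e
        using r by (simp add: scalar_prod_def if_distrib[of "\<lambda>x. x * _"] if_distrib[of "\<lambda>x. _ * x"] cong: if_cong)
      then show ?thesis .
    qed
    finally show ?thesis using d by simp
  qed
  then show ?thesis by blast
qed

lemma row_minor_GL: "g \<in> GL n \<Longrightarrow> row_minor (\<lambda>i. i) n g \<noteq> 0"
  using row_minor_det by (auto simp: GL_iff_det)

lemma in_cols_GL: "g \<in> GL n \<Longrightarrow> in_cols n g n y"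
  unfolding in_cols_def by (rule row_minor_solve[OF row_minor_GL])

section \<open>Parametrization of the preimage of the Hessenberg variety\<close>

locale two_block_hessenberg =
  fixes n p q :: nat and a b :: complex and m :: "nat \<Rightarrow> nat"
  assumes n: "n = p + q" and q: "1 \<le> q" "q \<le> p" and ab: "a \<noteq> b"
    and m: "hessenberg_vector n m"
begin

abbreviation hess :: "(nat \<Rightarrow> complex vec set) set" where
  "hess \<equiv> Hess n (diag_two p q a b) m"

definition X :: "complex mat set" where
  "X = {g \<in> GL n. flag_of n g \<in> hess}"

lemma m_mono: "1 \<le> i \<Longrightarrow> i \<le> j \<Longrightarrow> j \<le> n \<Longrightarrow> m i \<le> m j"
  using m mono_onD[of "{1..n}" m i j] unfolding hessenberg_vector_def by auto

lemma m_bounds: "1 \<le> i \<Longrightarrow> i \<le> n \<Longrightarrow> i \<le> m i \<and> m i \<le> n"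
  using m unfolding hessenberg_vector_def by auto

text \<open>The condition only involves the projection \<open>(x - a) / (b - a)\<close> onto the last \<open>q\<close>
  coordinates.\<close>

lemma mem_X_iff:
  assumes g: "g \<in> GL n"
  shows "g \<in> X \<longleftrightarrow> (\<forall>j<n. in_cols n g (m (Suc j)) (\<lambda>r. if r < p then 0 else g $$ (r, j)))"
proof
  have gc: "g \<in> carrier_mat n n" using g by (simp add: GL_def)
  have D: "diag_two p q a b = mat n n (\<lambda>(i, j). if i = j then (if j < p then a else b) else 0)"
    unfolding diag_two_def mat_diag_def n ..
  have xc: "diag_two p q a b *\<^sub>v v \<in> carrier_vec n" for v
    unfolding D carrier_vec_def by simp
  have x: "(diag_two p q a b *\<^sub>v v) $ r = (if r < p then a else b) * v $ r"
    if "v \<in> carrier_vec n" "r < n" for v r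
  proof -
    have "(diag_two p q a b *\<^sub>v v) $ r =
        (\<Sum>k = 0..<n. (if r = k then (if k < p then a else b) else 0) * v $ k)"
      unfolding D using that by (simp add: scalar_prod_def)
    also have "\<dots> = (\<Sum>k = 0..<n. if k = r then (if r < p then a else b) * v $ r else 0)"
      by (intro sum.cong) auto
    also have "\<dots> = (if r < p then a else b) * v $ r" using that(2) by simp
    finally show ?thesis .
  qed
  have fl: "flag_of n g i = col_span n g i" if "1 \<le> i" "i \<le> n" for i
    using flag_of_eq_col_span[OF gc] that by blast
  {
    assume "g \<in> X"
    then have H: "diag_two p q a b *\<^sub>v v \<in> flag_of n g (m i)" if "i \<in> {1..n}" "v \<in> flag_of n g i" for i v
      using that unfolding X_def Hess_def by blast
    show "\<forall>j<n. in_cols n g (m (Suc j)) (\<lambda>r. if r < p then 0 else g $$ (r, j))"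
    proof (intro allI impI)
      fix j assume j: "j < n"
      have mj: "Suc j \<le> m (Suc j)" "m (Suc j) \<le> n" using m_bounds[of "Suc j"] j by auto
      have "col g j \<in> flag_of n g (Suc j)"
        using j gc fl[of "Suc j"] in_cols_col[of j "Suc j" n g]
        by (auto simp: mem_col_span_iff elim: in_cols_cong)
      then have "diag_two p q a b *\<^sub>v col g j \<in> col_span n g (m (Suc j))"
        using H[of "Suc j"] j fl[of "m (Suc j)"] mj by simp
      then have 1: "in_cols n g (m (Suc j)) (\<lambda>r. (diag_two p q a b *\<^sub>v col g j) $ r)"
        by (simp add: mem_col_span_iff)
      have 2: "in_cols n g (m (Suc j)) (\<lambda>r. g $$ (r, j))" using mj by (intro in_cols_col) auto
      have c: "col g j \<in> carrier_vec n" using gc by auto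
      have "in_cols n g (m (Suc j)) (\<lambda>r. (1 / (b - a)) * ((diag_two p q a b *\<^sub>v col g j) $ r + (- a) * g $$ (r, j)))"
        by (intro in_cols_scale in_cols_add 1 2)
      then show "in_cols n g (m (Suc j)) (\<lambda>r. if r < p then 0 else g $$ (r, j))"
      proof (rule in_cols_cong)
        fix r assume r: "r < n"
        have "col g j $ r = g $$ (r, j)" using r j gc by simp
        then show "(1 / (b - a)) * ((diag_two p q a b *\<^sub>v col g j) $ r + (- a) * g $$ (r, j)) =
            (if r < p then 0 else g $$ (r, j))"
          unfolding x[OF c r] using ab by (simp add: field_simps)
      qed
    qed
  }
  assume R: "\<forall>j<n. in_cols n g (m (Suc j)) (\<lambda>r. if r < p then 0 else g $$ (r, j))"
  have "diag_two p q a b *\<^sub>v v \<in> flag_of n g (m i)" if i: "1 \<le> i" "i \<le> n" and v: "v \<in> flag_of n g i" for i v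
  proof -
    have mi: "i \<le> m i" "m i \<le> n" using m_bounds i by auto
    have v': "v \<in> carrier_vec n" "in_cols n g i (\<lambda>r. v $ r)"
      using v fl i by (auto simp: mem_col_span_iff)
    then obtain c where c: "\<And>r. r < n \<Longrightarrow> v $ r = (\<Sum>j<i. c j * g $$ (r, j))"
      unfolding in_cols_def by blast
    have j: "in_cols n g (m i) (\<lambda>r. if r < p then 0 else g $$ (r, j))" if "j < i" for j
    proof -
      have "in_cols n g (m (Suc j)) (\<lambda>r. if r < p then 0 else g $$ (r, j))" using R that i by simp
      then show ?thesis by (rule in_cols_mono) (use m_mono[of "Suc j" i] that i in auto)
    qed
    \<comment> \<open>The matrix is \<open>a\<close> plus \<open>b - a\<close> times the projection
      onto the last coordinates, and monotonicity of \<open>m\<close> has carried the conditions on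
      the columns before \<open>i\<close> to the level \<open>m i\<close>.\<close>
    have "in_cols n g (m i) (\<lambda>r. a * v $ r + (\<Sum>j<i. ((b - a) * c j) * (if r < p then 0 else g $$ (r, j))))"
      using in_cols_mono[OF v'(2) mi(1)]
      by (intro in_cols_add in_cols_scale[of n g "m i" "\<lambda>r. v $ r"] in_cols_sum in_cols_scale j) auto
    then have "in_cols n g (m i) (\<lambda>r. (diag_two p q a b *\<^sub>v v) $ r)"
    proof (rule in_cols_cong)
      fix r assume r: "r < n"
      have "(\<Sum>j<i. ((b - a) * c j) * (if r < p then 0 else g $$ (r, j))) = (if r < p then 0 else (b - a) * v $ r)"
        using c[OF r] by (simp add: sum_distrib_left mult.assoc)
      then show "a * v $ r + (\<Sum>j<i. ((b - a) * c j) * (if r < p then 0 else g $$ (r, j))) =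
          (diag_two p q a b *\<^sub>v v) $ r"
        unfolding x[OF v'(1) r] by (simp add: algebra_simps)
    qed
    then show ?thesis
      using fl[of "m i"] mi i xc[of v] by (simp add: mem_col_span_iff)
  qed
  then show "g \<in> X" unfolding X_def Hess_def using g flag_of_in_flags by auto
qed

text \<open>Each column is then an eigenvector: the projection onto the last \<open>q\<close>
  coordinates fixes or kills it, so the flag is stable under the matrix.\<close>

lemma block_columns_mem_X:
  assumes g: "g \<in> GL n"
    and "\<And>j. j < n \<Longrightarrow> (\<forall>r<p. g $$ (r, j) = 0) \<or> (\<forall>r<n. p \<le> r \<longrightarrow> g $$ (r, j) = 0)"
  shows "g \<in> X"
  unfolding mem_X_iff[OF g]
proof (intro allI impI)
  fix j assume j: "j < n"
  show "in_cols n g (m (Suc j)) (\<lambda>r. if r < p then 0 else g $$ (r, j))"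
  proof (cases "\<forall>r<p. g $$ (r, j) = 0")
    case True
    have "in_cols n g (m (Suc j)) (\<lambda>r. g $$ (r, j))"
      using m_bounds[of "Suc j"] j by (intro in_cols_col) auto
    then show ?thesis by (rule in_cols_cong) (use True in auto)
  next
    case False
    then have "\<forall>r<n. p \<le> r \<longrightarrow> g $$ (r, j) = 0" using assms(2)[OF j] by blast
    then show ?thesis by (intro in_cols_cong[OF in_cols_zero]) auto
  qed
qed

lemma one_mem_X: "1\<^sub>m n \<in> X"
  by (rule block_columns_mem_X) (auto simp: GL_iff_det)

lemma row_minor_one: "k \<le> n \<Longrightarrow> row_minor (\<lambda>i. i) k (1\<^sub>m n) = 1"
proof -
  assume "k \<le> n"
  then have "mat k k (\<lambda>(i, j). 1\<^sub>m n $$ (i, j)) = (1\<^sub>m k :: complex mat)" by (intro eq_matI) auto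
  then show ?thesis unfolding row_minor_def by simp
qed

lemma swap_mem_X: "\<exists>w\<in>X. row_minor (\<lambda>i. p + i) q w \<noteq> 0"
proof
  \<comment> \<open>The first \<open>q\<close> columns become the last \<open>q\<close> standard
    basis vectors and span a complement of the \<open>a\<close>-eigenspace.\<close>
  define \<sigma> where "\<sigma> j = (if j < q then p + j else j - q)" for j
  define w :: "complex mat" where "w = mat n n (\<lambda>(i, j). if i = \<sigma> j then 1 else 0)"
  have \<sigma>: "\<sigma> j < n" "\<sigma> i = \<sigma> j \<longleftrightarrow> i = j" if "i < n" "j < n" for i j
    using that q n by (auto simp: \<sigma>_def split: if_splits)
  have wc: "w \<in> carrier_mat n n" by (simp add: w_def)
  have "det w \<noteq> 0"
  proof
    assume "det w = 0"
    then obtain v where v: "v \<in> carrier_vec n" "v \<noteq> 0\<^sub>v n" "w *\<^sub>v v = 0\<^sub>v n"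
      using det_0_iff_vec_prod_zero[OF wc] by blast
    have "v $ j = 0" if j: "j < n" for j
    proof -
      have "(w *\<^sub>v v) $ \<sigma> j = (\<Sum>k = 0..<n. (if \<sigma> j = \<sigma> k then 1 else 0) * v $ k)"
        using \<sigma>(1)[OF j j] v(1) by (simp add: w_def scalar_prod_def)
      also have "\<dots> = (\<Sum>k = 0..<n. if k = j then v $ k else 0)"
        using \<sigma>(2) j by (intro sum.cong) auto
      also have "\<dots> = v $ j" using j by simp
      finally show ?thesis using v(3) \<sigma>(1)[OF j j] by simp
    qed
    then have "v = 0\<^sub>v n" using v(1) by (intro eq_vecI) auto
    then show False using v(2) by blast
  qed
  then have "w \<in> GL n" using wc by (simp add: GL_iff_det)
  then show "w \<in> X"
    using n by (intro block_columns_mem_X) (auto simp: w_def \<sigma>_def)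
  have "mat q q (\<lambda>(i, j). w $$ (p + i, j)) = 1\<^sub>m q"
    using n by (intro eq_matI) (auto simp: w_def \<sigma>_def)
  then show "row_minor (\<lambda>i. p + i) q w \<noteq> 0" unfolding row_minor_def by simp
qed

text \<open>One minor is nonzero at the identity, the other at the permuted flag; primality supplies
  a single \<open>g\<close> at which both are nonzero. The conclusions then follow from the
  Hessenberg conditions on the first \<open>q\<close> columns of this \<open>g\<close>.\<close>

lemma prime_imp_large:
  assumes "zariski_prime n X"
  shows "p \<le> m 1" "m q = n"
proof -
  let ?F = "row_minor (\<lambda>i. i) p" and ?G = "row_minor (\<lambda>i. p + i) q"
  have "?F \<in> mat_poly_funs n" "?G \<in> mat_poly_funs n"
    using n by (auto intro!: row_minor_poly)
  moreover have "\<not> (\<forall>g\<in>X. ?F g = 0)" using one_mem_X row_minor_one[of p] n by force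
  moreover have "\<not> (\<forall>g\<in>X. ?G g = 0)" using swap_mem_X by blast
  ultimately have "\<exists>g\<in>X. ?F g * ?G g \<noteq> 0"
    using assms unfolding zariski_prime_def by blast
  then obtain g where gX: "g \<in> X" and F: "?F g \<noteq> 0" and G: "?G g \<noteq> 0" by auto
  have g: "g \<in> GL n" using gX by (simp add: X_def)
  have R: "in_cols n g (m (Suc j)) (\<lambda>r. if r < p then 0 else g $$ (r, j))" if "j < n" for j
    using gX that mem_X_iff[OF g] by blast
  show m1: "p \<le> m 1"
  proof (rule ccontr)
    assume "\<not> p \<le> m 1"
    \<comment> \<open>The projected first column would lie in the span of the first \<open>p\<close>
      columns, which by \<open>F\<close> meets the \<open>b\<close>-eigenspace only in zero. The
      first column would then vanish in the last \<open>q\<close> rows, against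
      \<open>G\<close>.\<close>
    then have "in_cols n g p (\<lambda>r. if r < p then 0 else g $$ (r, 0))"
      using R[of 0] n q by (auto intro: in_cols_mono)
    then obtain c where c: "\<And>r. r < n \<Longrightarrow> (if r < p then 0 else g $$ (r, 0)) = (\<Sum>l<p. c l * g $$ (r, l))"
      unfolding in_cols_def by blast
    have c0: "c l = 0" if "l < p" for l
    proof (rule row_minor_kernel[OF F _ that])
      fix r assume "r < p"
      then show "(\<Sum>l<p. c l * g $$ (r, l)) = 0" using c[of r] n by simp
    qed
    have "(\<Sum>l<q. (if l = 0 then 1 else 0) * g $$ (p + r, l)) = 0" if "r < q" for r
    proof -
      have "(\<Sum>l<q. (if l = 0 then 1 else 0) * g $$ (p + r, l)) = g $$ (p + r, 0)"
        using q by (simp add: if_distrib[of "\<lambda>x. x * _"] cong: if_cong)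
      also have "\<dots> = 0" using c[of "p + r"] c0 that n by simp
      finally show ?thesis .
    qed
    from row_minor_kernel[OF G this, of 0] q show False by simp
  qed
  show "m q = n"
  proof (rule ccontr)
    assume "m q \<noteq> n"
    then have mq: "m q < n" using m_bounds[of q] q n by auto
    have pm: "p \<le> m q" using m1 m_mono[of 1 q] q n by auto
    \<comment> \<open>By \<open>G\<close>, the projections of the first \<open>q\<close> columns
      span the \<open>b\<close>-eigenspace, and each of them lies in the span of the first
      \<open>m q\<close> columns.\<close>
    have low: "in_cols n g (m q) y" if y: "\<And>r. r < p \<Longrightarrow> y r = 0" for y
    proof -
      obtain c where c: "\<And>r. r < q \<Longrightarrow> y (p + r) = (\<Sum>l<q. c l * g $$ (p + r, l))"
        using row_minor_solve[OF G, of "\<lambda>r. y (p + r)"] by blast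
      have "in_cols n g (m q) (\<lambda>r. \<Sum>l<q. c l * (if r < p then 0 else g $$ (r, l)))"
      proof (intro in_cols_sum in_cols_scale)
        fix l assume "l \<in> {..<q}"
        then show "in_cols n g (m q) (\<lambda>r. if r < p then 0 else g $$ (r, l))"
          using R[of l] m_mono[of "Suc l" q] n by (auto intro: in_cols_mono)
      qed
      then show ?thesis
      proof (rule in_cols_cong)
        fix r assume "r < n"
        then show "(\<Sum>l<q. c l * (if r < p then 0 else g $$ (r, l))) = y r"
          using y[of r] c[of "r - p"] n by (cases "r < p") auto
      qed
    qed
    \<comment> \<open>By \<open>F\<close>, the last column is a combination of the first
      \<open>p\<close> columns plus a vector of the \<open>b\<close>-eigenspace. Hence it would
      depend on the columns before it.\<close>
    obtain \<alpha> where \<alpha>: "\<And>r. r < p \<Longrightarrow> g $$ (r, n - 1) = (\<Sum>l<p. \<alpha> l * g $$ (r, l))"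
      using row_minor_solve[OF F, of "\<lambda>r. g $$ (r, n - 1)"] by blast
    have "in_cols n g (m q) (\<lambda>r. g $$ (r, n - 1) - (\<Sum>l<p. \<alpha> l * g $$ (r, l)))"
      using \<alpha> by (intro low) simp
    moreover have "in_cols n g (m q) (\<lambda>r. \<Sum>l<p. \<alpha> l * g $$ (r, l))"
      using pm by (intro in_cols_sum in_cols_scale in_cols_col) auto
    ultimately have "in_cols n g (m q) (\<lambda>r. (g $$ (r, n - 1) - (\<Sum>l<p. \<alpha> l * g $$ (r, l))) + (\<Sum>l<p. \<alpha> l * g $$ (r, l)))"
      by (rule in_cols_add)
    then have "in_cols n g (n - 1) (\<lambda>r. g $$ (r, n - 1))"
      using mq by (auto intro: in_cols_mono)
    then obtain c where c: "\<And>r. r < n \<Longrightarrow> g $$ (r, n - 1) = (\<Sum>l<n - 1. c l * g $$ (r, l))"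
      unfolding in_cols_def by blast
    have n1: "{..<n} = insert (n - 1) {..<n - 1}" using n q by auto
    have "(\<Sum>l<n. (if l = n - 1 then - 1 else c l) * g $$ (r, l)) = 0" if "r < n" for r
      unfolding n1 using c[OF that] by simp
    from row_minor_kernel[OF row_minor_GL[OF g] this, of "n - 1"] n q show False by simp
  qed
qed

definition base_entry :: "(nat \<times> nat \<Rightarrow> complex) \<Rightarrow> nat \<Rightarrow> nat \<Rightarrow> complex" where
  "base_entry t i j =
     (if i < p \<or> q \<le> j then t (j, i) else (\<Sum>k=p..<m (Suc j). t (j, k) * t (k, i)))"

text \<open>Parameters are indexed by (column, row).  A column \<open>j < q\<close> has lower part in the span of
  the vectors \<open>\<lambda>i. t (k, i)\<close> for \<open>p \<le> k < m (Suc j)\<close>; a column \<open>k \<ge> p\<close> is such a vector up to a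
  combination of the first \<open>p\<close> columns.\<close>

definition param :: "(nat \<times> nat \<Rightarrow> complex) \<Rightarrow> complex mat" where
  "param t = mat n n (\<lambda>(i, j). if j < p then base_entry t i j
     else (\<Sum>l<p. t (j, l) * base_entry t i l) + (if p \<le> i then t (j, i) else 0))"

text \<open>Column \<open>j\<close> consumes \<open>m (Suc j)\<close> parameters: for
  \<open>j < q\<close> these are the \<open>p\<close> upper entries and the coefficients with index
  in \<open>{p..<m (Suc j)}\<close>; from column \<open>q\<close> on there are \<open>n\<close> of
  them. This count is accurate once \<open>p \<le> m 1\<close> and \<open>m q = n\<close> are
  known.\<close>

definition param_index :: "(nat \<times> nat) set" where
  "param_index = (SIGMA j:{..<n}. {..<m (Suc j)})"

lemma param_carrier [simp]: "param t \<in> carrier_mat n n"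
  by (simp add: param_def)

lemma finite_param_index: "finite param_index"
  by (simp add: param_index_def)

lemma card_param_index: "card param_index = (\<Sum>i=1..n. m i)"
proof -
  have "card param_index = (\<Sum>j<n. m (Suc j))" by (simp add: param_index_def)
  also have "\<dots> = (\<Sum>i=1..n. m i)"
    using sum.atLeast1_atMost_eq[of m n] by simp
  finally show ?thesis .
qed

end

locale large_two_block_hessenberg = two_block_hessenberg +
  assumes p_le: "p \<le> m 1" and m_q: "m q = n"
begin

lemma m_Suc_large: "q \<le> Suc j \<Longrightarrow> j < n \<Longrightarrow> m (Suc j) = n"
  using m_mono[of q "Suc j"] m_bounds[of "Suc j"] m_q q by auto

lemma p_le_m: "j < n \<Longrightarrow> p \<le> m (Suc j)"
  using m_mono[of 1 "Suc j"] p_le by auto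

text \<open>The bound \<open>3\<close> comes from the columns \<open>j \<ge> p\<close>: a
  coefficient times a base entry, which is itself at most quadratic.\<close>

lemma param_box_poly:
  assumes "i < n" "j < n"
  shows "box_poly param_index 3 (\<lambda>t. param t $$ (i, j))"
proof -
  note fin = finite_param_index
  have var: "box_poly param_index 1 (\<lambda>t. t (j, i))" if "j < n" "i < m (Suc j)" for i j
    using that by (intro box_poly_var[OF fin]) (auto simp: param_index_def)
  have base: "box_poly param_index 2 (\<lambda>t. base_entry t i j)" if "i < n" "j < p" for i j
  proof (cases "i < p \<or> q \<le> j")
    case True
    then have "i < m (Suc j)" using that n p_le_m[of j] m_Suc_large[of j] by auto
    then show ?thesis using True that n box_poly_mono[OF fin var, of j i 2]
      by (simp add: base_entry_def)
  next
    case False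
    have "box_poly param_index (1 + 1) (\<lambda>t. t (j, k) * t (k, i))" if k: "k \<in> {p..<m (Suc j)}" for k
    proof (intro box_poly_mult[OF fin] var)
      have "k < n" using k m_bounds[of "Suc j"] \<open>j < p\<close> n by auto
      then show "k < n" "i < m (Suc k)" using m_Suc_large[of k] k q \<open>i < n\<close> by auto
    qed (use k \<open>j < p\<close> n in auto)
    then have "box_poly param_index (1 + 1) (\<lambda>t. \<Sum>k=p..<m (Suc j). t (j, k) * t (k, i))"
      by (rule box_poly_sum[OF fin])
    then show ?thesis using False by (simp add: base_entry_def numeral_2_eq_2)
  qed
  show ?thesis
  proof (cases "j < p")
    case True
    then show ?thesis using assms box_poly_mono[OF fin base[OF assms(1) True], of 3]
      by (simp add: param_def)
  next
    case False
    have mj: "m (Suc j) = n" using False q assms by (intro m_Suc_large) auto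
    have "box_poly param_index (1 + 2) (\<lambda>t. t (j, l) * base_entry t i l)" if "l \<in> {..<p}" for l
      using that assms n mj by (intro box_poly_mult[OF fin] var base) auto
    then have s: "box_poly param_index (1 + 2) (\<lambda>t. \<Sum>l<p. t (j, l) * base_entry t i l)"
      by (rule box_poly_sum[OF fin])
    have "box_poly param_index (1 + 2) (\<lambda>t. if p \<le> i then t (j, i) else 0)"
    proof (cases "p \<le> i")
      case True
      then show ?thesis using box_poly_mono[OF fin var[of j i], of "1 + 2"] assms mj by simp
    qed (simp add: box_poly_const[OF fin])
    from box_poly_add[OF s this]
    have "box_poly param_index (1 + 2) (\<lambda>t. param t $$ (i, j))"
      using False assms by (simp add: param_def)
    then show ?thesis by (simp add: numeral_3_eq_3)
  qed
qed

text \<open>For \<open>j \<ge> q\<close> the condition is empty because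
  \<open>m (Suc j) = n\<close>. For \<open>j < q\<close>, the lower vectors spanning the projected
  column are columns \<open>k\<close> with \<open>p \<le> k < m (Suc j)\<close>, minus combinations
  of the first \<open>p\<close> columns.\<close>

lemma param_mem_X:
  assumes g: "param t \<in> GL n"
  shows "param t \<in> X"
  unfolding mem_X_iff[OF g]
proof (intro allI impI)
  fix j assume j: "j < n"
  show "in_cols n (param t) (m (Suc j)) (\<lambda>r. if r < p then 0 else param t $$ (r, j))"
  proof (cases "j < q")
    case False
    then show ?thesis using m_Suc_large[of j] j in_cols_GL[OF g] by simp
  next
    case True
    have w: "in_cols n (param t) (m (Suc j)) (\<lambda>r. if p \<le> r then t (k, r) else 0)" if k: "k \<in> {p..<m (Suc j)}" for k
    proof -
      have kn: "k < n" using k m_bounds[of "Suc j"] j by auto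
      have "in_cols n (param t) (m (Suc j)) (\<lambda>r. param t $$ (r, k) + (-1) * (\<Sum>l<p. t (k, l) * param t $$ (r, l)))"
        using k p_le_m[OF j] by (intro in_cols_add in_cols_col in_cols_scale in_cols_sum) auto
      then show ?thesis
      proof (rule in_cols_cong)
        fix r assume r: "r < n"
        have "(\<Sum>l<p. t (k, l) * param t $$ (r, l)) = (\<Sum>l<p. t (k, l) * base_entry t r l)"
          using r kn k by (intro sum.cong) (auto simp: param_def)
        then show "param t $$ (r, k) + (-1) * (\<Sum>l<p. t (k, l) * param t $$ (r, l)) = (if p \<le> r then t (k, r) else 0)"
          using r kn k by (simp add: param_def)
      qed
    qed
    have "in_cols n (param t) (m (Suc j)) (\<lambda>r. \<Sum>k=p..<m (Suc j). t (j, k) * (if p \<le> r then t (k, r) else 0))"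
      by (intro in_cols_sum in_cols_scale w)
    then show ?thesis
    proof (rule in_cols_cong)
      fix r assume r: "r < n"
      show "(\<Sum>k=p..<m (Suc j). t (j, k) * (if p \<le> r then t (k, r) else 0)) =
          (if r < p then 0 else param t $$ (r, j))"
        using True q r j by (auto simp: param_def base_entry_def)
    qed
  qed
qed

text \<open>The minor lets the upper part of every column be expressed by those of the first
  \<open>p\<close> columns; \<alpha> records the coefficients and \<open>w\<close> the remainder,
  which lives in the last \<open>q\<close> rows. The Hessenberg condition supplies the coefficients
  \<open>c\<close>.\<close>

lemma mem_X_imp_param:
  assumes gX: "g \<in> X" and F: "row_minor (\<lambda>i. i) p g \<noteq> 0"
  shows "\<exists>t. param t = g"
proof -
  have g: "g \<in> GL n" and gc: "g \<in> carrier_mat n n" using gX by (auto simp: X_def GL_def)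
  have "\<exists>c. \<forall>r<n. (if r < p then 0 else g $$ (r, j)) = (\<Sum>k<m (Suc j). c k * g $$ (r, k))" if "j < n" for j
    using gX that mem_X_iff[OF g] unfolding in_cols_def by blast
  then obtain c where c: "\<And>j r. j < n \<Longrightarrow> r < n \<Longrightarrow>
      (if r < p then 0 else g $$ (r, j)) = (\<Sum>k<m (Suc j). c j k * g $$ (r, k))"
    by metis
  have "\<exists>\<alpha>. \<forall>r<p. g $$ (r, j) = (\<Sum>l<p. \<alpha> l * g $$ (r, l))" for j
    by (rule row_minor_solve[OF F])
  then obtain \<alpha> where \<alpha>: "\<And>j r. r < p \<Longrightarrow> g $$ (r, j) = (\<Sum>l<p. \<alpha> j l * g $$ (r, l))"
    by metis
  define w where "w j r = g $$ (r, j) - (\<Sum>l<p. \<alpha> j l * g $$ (r, l))" for j r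
  have w0: "w j r = 0" if "r < p" for j r
    unfolding w_def right_minus_eq by (rule \<alpha>[OF that])
  define t where "t ji = (case ji of (j, i) \<Rightarrow>
    if j < p then (if i < p \<or> q \<le> j then g $$ (i, j) else c j i)
    else (if i < p then \<alpha> j i else w j i))" for ji
  have base: "base_entry t i j = g $$ (i, j)" if "i < n" "j < p" for i j
  proof (cases "i < p \<or> q \<le> j")
    case True
    then show ?thesis using that by (simp add: base_entry_def t_def)
  next
    case False
    have jn: "j < n" using that n by simp
    let ?M = "m (Suc j)"
    \<comment> \<open>Expressing the columns \<open>k \<ge> p\<close> by \<open>w\<close> and the
      first \<open>p\<close> columns collects the coefficients of the latter in \<beta>. The upper
      rows of the projected column are zero, so the minor forces \<beta> to vanish.\<close>
    define \<beta> where "\<beta> l = c j l + (\<Sum>k=p..<?M. c j k * \<alpha> k l)" for l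
    have eq: "(if r < p then 0 else g $$ (r, j)) = (\<Sum>l<p. \<beta> l * g $$ (r, l)) + (\<Sum>k=p..<?M. c j k * w k r)"
      if "r < n" for r
    proof -
      have "(\<Sum>k<?M. c j k * g $$ (r, k)) = (\<Sum>k<p. c j k * g $$ (r, k)) + (\<Sum>k=p..<?M. c j k * g $$ (r, k))"
        using p_le_m[OF jn] by (simp add: lessThan_atLeast0 sum.atLeastLessThan_concat)
      also have "(\<Sum>k=p..<?M. c j k * g $$ (r, k)) =
          (\<Sum>k=p..<?M. c j k * w k r) + (\<Sum>k=p..<?M. \<Sum>l<p. c j k * \<alpha> k l * g $$ (r, l))"
        unfolding w_def by (simp add: right_diff_distrib sum_subtractf sum_distrib_left mult.assoc)
      also have "(\<Sum>k=p..<?M. \<Sum>l<p. c j k * \<alpha> k l * g $$ (r, l)) =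
          (\<Sum>l<p. (\<Sum>k=p..<?M. c j k * \<alpha> k l) * g $$ (r, l))"
        by (subst sum.swap) (simp add: sum_distrib_right)
      finally show ?thesis
        using c[OF jn that] by (simp add: \<beta>_def distrib_right sum.distrib)
    qed
    have "\<beta> l = 0" if "l < p" for l
    proof (rule row_minor_kernel[OF F _ that])
      fix r assume "r < p"
      then show "(\<Sum>l<p. \<beta> l * g $$ (r, l)) = 0" using eq[of r] w0 n by simp
    qed
    then have "g $$ (i, j) = (\<Sum>k=p..<?M. c j k * w k i)" using eq[OF that(1)] False by simp
    also have "\<dots> = base_entry t i j"
      using False that by (auto simp: base_entry_def t_def intro!: sum.cong)
    finally show ?thesis by simp
  qed
  have "param t = g"
  proof (rule eq_matI)
    fix i j assume "i < dim_row g" "j < dim_col g"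
    then have ij: "i < n" "j < n" using gc by auto
    show "param t $$ (i, j) = g $$ (i, j)"
    proof (cases "j < p")
      case True
      then show ?thesis using ij base by (simp add: param_def)
    next
      case False
      have "(\<Sum>l<p. t (j, l) * base_entry t i l) = (\<Sum>l<p. \<alpha> j l * g $$ (i, l))"
        using False ij base by (intro sum.cong) (auto simp: t_def)
      moreover have "(if p \<le> i then t (j, i) else 0) = w j i"
        using False w0 by (simp add: t_def)
      ultimately show ?thesis using False ij by (simp add: param_def w_def)
    qed
  qed (use gc in \<open>auto simp: param_def\<close>)
  then show ?thesis by blast
qed

text \<open>Functions vanishing on the image of \<open>param\<close> vanish on the part of
  \<open>X\<close> where the upper left minor is nonzero; multiplied by this minor they vanish on
  all of \<open>X\<close>, and primality cancels it.\<close>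

lemma growth_X:
  assumes prime: "zariski_prime n X" and "growth_ge n X d"
  shows "d \<le> (\<Sum>i=1..n. m i)"
  unfolding card_param_index[symmetric]
proof (rule growth_ge_param[OF finite_param_index param_box_poly _ assms(2)])
  fix f assume f: "f \<in> mat_poly_funs n" "\<And>t. f (param t) = 0"
  let ?F = "row_minor (\<lambda>i. i) p"
  have F: "?F \<in> mat_poly_funs n" using n by (auto intro!: row_minor_poly)
  have "\<forall>g\<in>X. f g * ?F g = 0" using mem_X_imp_param f(2) by (metis mult_eq_0_iff)
  moreover have "\<not> (\<forall>g\<in>X. ?F g = 0)" using one_mem_X row_minor_one[of p] n by force
  ultimately show "\<forall>z\<in>X. f z = 0"
    using prime f(1) F unfolding zariski_prime_def by blast
qed

end

section \<open>Upper bound for the length of chains\<close>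

text \<open>Freeing one more position of \<open>b\<close> enlarges the set strictly; the separating
  function reads that entry from \<open>g * b\<close> by multiplying with the inverse of
  \<open>g\<close>.\<close>

lemma growth_coset_part:
  assumes g: "g \<in> GL n" and "finite S" "S \<subseteq> (SIGMA j:{..<n}. {..j})"
  shows "growth_ge n (coset_part n g S) (card S)"
  using assms(2,3)
proof (induction S rule: finite_induct)
  case empty
  have "1\<^sub>m n \<in> GL n" by (simp add: GL_iff_det)
  then have "g * 1\<^sub>m n \<in> coset_part n g {}" unfolding coset_part_def by fastforce
  then have "coset_part n g {} \<noteq> {}" by blast
  then show ?case using growth_ge_0 by simp
next
  case (insert x S)
  have gc: "g \<in> carrier_mat n n" using g by (simp add: GL_def)
  obtain h where h: "inverts_mat g h" "inverts_mat h g"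
    using g unfolding GL_def invertible_mat_def by blast
  have hg: "h * g = 1\<^sub>m n" "h \<in> carrier_mat n n"
  proof -
    have "g * h = 1\<^sub>m n" "h * g = 1\<^sub>m (dim_row h)" using h gc unfolding inverts_mat_def by auto
    then have "dim_col h = n" "dim_row h = n"
      using gc by (metis index_mult_mat(3) index_one_mat(3), metis carrier_matD(2) index_mult_mat(3) index_one_mat(3))
    with \<open>h * g = _\<close> show "h * g = 1\<^sub>m n" "h \<in> carrier_mat n n" by auto
  qed
  obtain j i where x: "x = (j, i)" "j < n" "i \<le> j" using insert.prems by auto
  \<comment> \<open>\<delta> is the value prescribed at the new position before it is freed.\<close>
  define \<delta> where "\<delta> = (if i = j then 1 else 0 :: complex)"
  define f where "f A = (\<Sum>k<n. h $$ (i, k) * A $$ (k, j)) + (- \<delta>)" for A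
  have f: "f (g * b) = b $$ (i, j) - \<delta>" if "b \<in> carrier_mat n n" for b
  proof -
    have "(\<Sum>k<n. h $$ (i, k) * (g * b) $$ (k, j)) = (h * (g * b)) $$ (i, j)"
      using x that hg gc by (simp add: scalar_prod_def lessThan_atLeast0)
    also have "h * (g * b) = b" using that hg gc by (simp flip: assoc_mult_mat)
    finally show ?thesis by (simp add: f_def)
  qed
  \<comment> \<open>The identity with the new entry raised by one: a diagonal entry becomes
    \<open>2\<close>, so the matrix stays invertible.\<close>
  define b where "b = mat n n (\<lambda>(r, c). if r = i \<and> c = j then \<delta> + 1 else if r = c then 1 else 0 :: complex)"
  have bc: "b \<in> carrier_mat n n" by (simp add: b_def)
  have "upper_triangular b" using x by (intro upper_triangularI) (auto simp: b_def)
  then have "det b = prod_list (diag_mat b)" using bc by (rule det_upper_triangular)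
  also have "\<dots> \<noteq> 0" by (auto simp: prod_list_zero_iff diag_mat_def b_def \<delta>_def)
  finally have b: "b \<in> GL n" using bc by (simp add: GL_iff_det)
  have "growth_ge n (coset_part n g (insert x S)) (Suc (card S))"
  proof (rule growth_ge_Suc)
    show "growth_ge n (coset_part n g S) (card S)" using insert by simp
    show "coset_part n g S \<subseteq> coset_part n g (insert x S)" unfolding coset_part_def by blast
    show "zariski_prime n (coset_part n g (insert x S))" by (rule zariski_prime_coset_part[OF g])
    show "f \<in> mat_poly_funs n"
      unfolding f_def
      by (intro mat_poly_funs.add mat_poly_sum mat_poly_funs.mult mat_poly_funs.const
          mat_poly_funs.entry) (use x in auto)
    show "f z = 0" if z: "z \<in> coset_part n g S" for z
    proof -
      obtain c where c: "c \<in> GL n" "z = g * c" "c $$ (i, j) = \<delta>"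
        using z x insert.hyps(2) unfolding coset_part_def \<delta>_def by fastforce
      then show ?thesis using f[of c] by (simp add: GL_def)
    qed
    have "\<forall>r<n. \<forall>c<n. (c, r) \<notin> insert x S \<longrightarrow> b $$ (r, c) = (if r = c then 1 else 0)"
      by (auto simp: b_def x)
    then show "g * b \<in> coset_part n g (insert x S)" using b unfolding coset_part_def by blast
    show "f (g * b) \<noteq> 0" using f[OF bc] x by (simp add: b_def)
  qed
  then show ?case using insert.hyps by simp
qed

lemma growth_fibre:
  assumes g: "g \<in> GL n"
  shows "growth_ge n {h \<in> GL n. flag_of n h = flag_of n g} (\<Sum>i=1..n. i)"
proof -
  let ?U = "SIGMA j:{..<n}. {..j}"
  have "card ?U = (\<Sum>j<n. Suc j)" by simp
  also have "\<dots> = (\<Sum>i=1..n. i)" using sum.atLeast1_atMost_eq[of "\<lambda>i. i" n] by simp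
  finally show ?thesis
    using growth_coset_part[OF g, of ?U] by (simp add: fibre_eq_coset_part[OF g])
qed

text \<open>The preimage of the first member contains a whole fibre, which starts the count at the
  dimension of the Borel subgroup. At each inclusion an equation of the smaller member fails on the
  larger one, whose preimage is prime.\<close>

lemma growth_of_chain:
  assumes H: "H \<subseteq> flags n"
  defines "T \<equiv> subtopology (flag_variety n) H"
  assumes cl: "\<And>i. i \<le> d \<Longrightarrow> closedin T (Z i)"
    and irr: "\<And>i. i \<le> d \<Longrightarrow> irreducible_space (subtopology T (Z i))"
    and strict: "\<And>i. i < d \<Longrightarrow> Z i \<subset> Z (Suc i)"
  shows "growth_ge n {g \<in> GL n. flag_of n g \<in> H} (d + (\<Sum>i=1..n. i))"
proof -
  have ZH: "Z i \<subseteq> H" if "i \<le> d" for i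
    using closedin_subset[OF cl[OF that]] unfolding T_def by auto
  have pr: "zariski_prime n {g \<in> GL n. flag_of n g \<in> Z i}" if "i \<le> d" for i
  proof (rule zariski_prime_preimage)
    show "Z i \<subseteq> flags n" using ZH[OF that] H by blast
    have "subtopology T (Z i) = subtopology (flag_variety n) (Z i)"
      using ZH[OF that] unfolding T_def subtopology_subtopology by (simp add: inf.absorb2)
    then show "irreducible_space (subtopology (flag_variety n) (Z i))" using irr[OF that] by simp
  qed
  have "growth_ge n {g \<in> GL n. flag_of n g \<in> Z i} (i + (\<Sum>i=1..n. i))" if "i \<le> d" for i
    using that
  proof (induction i)
    case 0
    have "Z 0 \<noteq> {}" using irr[of 0] unfolding irreducible_space_def by auto
    then obtain V where V: "V \<in> Z 0" by blast
    then obtain g where g: "g \<in> GL n" "flag_of n g = V" using flag_of_surj ZH[of 0] H by blast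
    then have "{h \<in> GL n. flag_of n h = flag_of n g} \<subseteq> {g \<in> GL n. flag_of n g \<in> Z 0}"
      using V by auto
    from growth_ge_superset[OF growth_fibre[OF g(1)] this] show ?case by simp
  next
    case (Suc i)
    have i: "i \<le> d" "i < d" using Suc.prems by auto
    obtain D where D: "closedin (flag_variety n) D" "Z i = D \<inter> H"
      using cl[OF i(1)] unfolding T_def closedin_subtopology by blast
    obtain S where S: "S \<subseteq> mat_poly_funs n" "\<And>g. g \<in> GL n \<Longrightarrow> flag_of n g \<in> D \<longleftrightarrow> (\<forall>f\<in>S. f g = 0)"
      by (rule closedin_flag_variety_preimage[OF D(1)]) (rule that)
    obtain V where V: "V \<in> Z (Suc i)" "V \<notin> Z i" using strict[OF i(2)] by blast
    then have VH: "V \<in> H" using ZH[OF Suc.prems] by blast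
    then obtain y where y: "y \<in> GL n" "flag_of n y = V" using flag_of_surj H by blast
    then have "flag_of n y \<notin> D" using V VH D(2) by blast
    then obtain f where f: "f \<in> S" "f y \<noteq> 0" using S(2)[OF y(1)] by auto
    have f0: "f z = 0" if "z \<in> {g \<in> GL n. flag_of n g \<in> Z i}" for z
      using that S(2)[of z] D(2) f(1) by auto
    have yZ: "y \<in> {g \<in> GL n. flag_of n g \<in> Z (Suc i)}" using y V by simp
    have "{g \<in> GL n. flag_of n g \<in> Z i} \<subseteq> {g \<in> GL n. flag_of n g \<in> Z (Suc i)}"
      using strict[OF i(2)] by blast
    from growth_ge_Suc[OF Suc.IH[OF i(1)] this pr[OF Suc.prems] subsetD[OF S(1) f(1)] f0 yZ f(2)]
    show ?case by simp
  qed
  from this[of d] have "growth_ge n {g \<in> GL n. flag_of n g \<in> Z d} (d + (\<Sum>i=1..n. i))" by simp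
  then show ?thesis by (rule growth_ge_superset) (use ZH[of d] in auto)
qed

lemma krull_dim_le_growth:
  assumes H: "H \<subseteq> flags n"
    and bound: "\<And>d. growth_ge n {g \<in> GL n. flag_of n g \<in> H} d \<Longrightarrow> d \<le> (\<Sum>i=1..n. i) + D"
  shows "krull_dim (subtopology (flag_variety n) H) \<le> enat D"
  unfolding krull_dim_def
proof (rule Sup_least)
  let ?T = "subtopology (flag_variety n) H"
  fix e assume "e \<in> {enat d | d. \<exists>Z :: nat \<Rightarrow> (nat \<Rightarrow> complex vec set) set.
     (\<forall>i\<le>d. closedin ?T (Z i) \<and> irreducible_space (subtopology ?T (Z i))) \<and>
     (\<forall>i<d. Z i \<subset> Z (Suc i))}"
  then obtain d and Z :: "nat \<Rightarrow> (nat \<Rightarrow> complex vec set) set" where d: "e = enat d"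
    "\<And>i. i \<le> d \<Longrightarrow> closedin ?T (Z i)"
    "\<And>i. i \<le> d \<Longrightarrow> irreducible_space (subtopology ?T (Z i))"
    "\<And>i. i < d \<Longrightarrow> Z i \<subset> Z (Suc i)"
    by blast
  have "d \<le> D" using bound[OF growth_of_chain[where Z = Z, OF H d(2,3,4)]] by simp
  then show "e \<le> enat D" using d(1) by simp
qed

section \<open>A chain of maximal length\<close>

lemma box_poly_on_line:
  assumes "box_poly I r f"
  shows "\<exists>p. \<forall>z. f (\<lambda>i. (1 - z) * t i + z * t' i) = poly p z"
proof -
  obtain c where c: "\<And>t. f t = (\<Sum>\<alpha>\<in>PiE I (\<lambda>_. {..r}). c \<alpha> * (\<Prod>i\<in>I. t i ^ \<alpha> i))"
    using assms unfolding box_poly_def by blast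
  have "f (\<lambda>i. (1 - z) * t i + z * t' i) =
      poly (\<Sum>\<alpha>\<in>PiE I (\<lambda>_. {..r}). Polynomial.smult (c \<alpha>) (\<Prod>i\<in>I. [:t i, t' i - t i:] ^ \<alpha> i)) z" for z
    unfolding c by (simp add: poly_sum poly_prod poly_power algebra_simps)
  then show ?thesis by blast
qed

text \<open>Rows \<open>0, ..., j - 1\<close> and \<open>i\<close> form a lower triangular matrix
  with diagonal \<open>1, ..., 1, u $$ (i, j)\<close>. Hence the entry is a minor of the first
  columns, whose vanishing depends only on the flag.\<close>

lemma row_minor_lower_unitriangular:
  assumes u: "\<And>r c. r < c \<Longrightarrow> c < n \<Longrightarrow> u $$ (r, c) = 0" "\<And>r. r < n \<Longrightarrow> u $$ (r, r) = 1"
    and ij: "j < i" "i < n"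
  shows "row_minor (\<lambda>r. if r < j then r else i) (Suc j) u = u $$ (i, j)"
proof -
  let ?M = "mat (Suc j) (Suc j) (\<lambda>(r, c). u $$ (if r < j then r else i, c))"
  have "det ?M = prod_list (diag_mat ?M)"
    by (rule det_lower_triangular[of "Suc j"]) (use u(1) ij in auto)
  also have "diag_mat ?M = map (\<lambda>_. 1) [0..<j] @ [u $$ (i, j)]"
    unfolding diag_mat_def using u(2) ij by simp
  also have "prod_list \<dots> = u $$ (i, j)" by (simp add: map_replicate_const)
  finally show ?thesis unfolding row_minor_def .
qed

section \<open>Closures of the images of coordinate subspaces\<close>

context large_two_block_hessenberg
begin

definition free_index :: "(nat \<times> nat) set" where
  "free_index = (SIGMA j:{..<n}. {Suc j..<m (Suc j)})"

text \<open>The remaining parameters keep their values at the identity matrix; for \<open>S\<close>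
  inside \<open>free_index\<close> this makes \<open>param t\<close> lower unitriangular.\<close>

definition unipotent_params :: "(nat \<times> nat) set \<Rightarrow> (nat \<times> nat \<Rightarrow> complex) set" where
  "unipotent_params S = {t. \<forall>j i. (j, i) \<notin> S \<longrightarrow> t (j, i) = (if i = j then 1 else 0)}"

lemma unipotent_paramsD:
  "t \<in> unipotent_params S \<Longrightarrow> (j, i) \<notin> S \<Longrightarrow> t (j, i) = (if i = j then 1 else 0)"
  by (simp add: unipotent_params_def)

lemma finite_free_index: "finite free_index"
  by (simp add: free_index_def)

lemma card_free_index: "card free_index = (\<Sum>i=1..n. m i - i)"
proof -
  have "card free_index = (\<Sum>j<n. m (Suc j) - Suc j)" by (simp add: free_index_def)
  also have "\<dots> = (\<Sum>i=1..n. m i - i)"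
    using sum.atLeast1_atMost_eq[of "\<lambda>i. m i - i" n] by simp
  finally show ?thesis .
qed

lemma param_unitriangular:
  assumes S: "S \<subseteq> free_index" and t: "t \<in> unipotent_params S" and ij: "i \<le> j" "j < n"
  shows "param t $$ (i, j) = (if i = j then 1 else 0)"
proof -
  have t': "t (c, r) = (if r = c then 1 else 0)" if "r \<le> c" for c r
  proof (rule unipotent_paramsD[OF t])
    show "(c, r) \<notin> S" using S that by (auto simp: free_index_def)
  qed
  show ?thesis
  proof (cases "j < p")
    case True
    then show ?thesis using ij q t'[OF ij(1)] by (simp add: param_def base_entry_def)
  next
    case False
    have "(\<Sum>l<p. t (j, l) * base_entry t i l) = 0"
      using False t' by (intro sum.neutral) auto
    then show ?thesis using False ij t'[OF ij(1)] by (auto simp: param_def)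
  qed
qed

lemma param_GL:
  assumes "S \<subseteq> free_index" "t \<in> unipotent_params S"
  shows "param t \<in> GL n"
proof -
  have "det (param t) = prod_list (diag_mat (param t))"
    by (rule det_lower_triangular[of n]) (use param_unitriangular[OF assms] in auto)
  also have "\<dots> \<noteq> 0"
    using param_unitriangular[OF assms] by (auto simp: prod_list_zero_iff diag_mat_def carrier_matD[OF param_carrier])
  finally show ?thesis by (simp add: GL_iff_det)
qed

text \<open>For \<open>j < q\<close> and \<open>i \<ge> p\<close> the entry is a sum of products
  \<open>t (j, k) * t (k, i)\<close> with \<open>k \<ge> p > j\<close>. As no position in a column
  after \<open>j\<close> is free, \<open>t (k, i)\<close> is the Kronecker delta and the sum
  collapses.\<close>

lemma param_entry:
  assumes S: "S \<subseteq> free_index" and t: "t \<in> unipotent_params S"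
    and ij: "(j, i) \<in> free_index" and last: "\<And>k r. (k, r) \<in> S \<Longrightarrow> k \<le> j"
  shows "param t $$ (i, j) = t (j, i)"
proof -
  have jn: "j < i" "i < m (Suc j)" "j < n" using ij by (auto simp: free_index_def)
  then have i: "i < n" using m_bounds[of "Suc j"] by auto
  show ?thesis
  proof (cases "j < p")
    case True
    show ?thesis
    proof (cases "i < p \<or> q \<le> j")
      case True
      then show ?thesis using \<open>j < p\<close> i jn by (simp add: param_def base_entry_def)
    next
      case False
      have "t (k, i) = (if i = k then 1 else 0)" if "p \<le> k" for k
        using that True last[of k i] by (intro unipotent_paramsD[OF t]) auto
      then have "(\<Sum>k=p..<m (Suc j). t (j, k) * t (k, i)) = (\<Sum>k=p..<m (Suc j). if k = i then t (j, i) else 0)"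
        by (intro sum.cong) auto
      also have "\<dots> = t (j, i)" using False jn by simp
      finally show ?thesis using True False i jn by (simp add: param_def base_entry_def)
    qed
  next
    case False
    have "t (j, l) = 0" if "l < p" for l
    proof -
      have "(j, l) \<notin> S" using S that False by (auto simp: free_index_def)
      from unipotent_paramsD[OF t this] show ?thesis using that False by simp
    qed
    then have "(\<Sum>l<p. t (j, l) * base_entry t i l) = 0" by (intro sum.neutral) auto
    then show ?thesis using False i jn by (simp add: param_def)
  qed
qed

text \<open>Segments between unipotent parameters stay unipotent, and \<open>param\<close> maps them
  to polynomial curves inside the set.\<close>

lemma zariski_prime_params:
  assumes S: "S \<subseteq> free_index"
  shows "zariski_prime n (param ` unipotent_params S)"
proof (rule zariski_primeI)
  fix y y' assume "y \<in> param ` unipotent_params S" "y' \<in> param ` unipotent_params S"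
  then obtain t t' where t: "t \<in> unipotent_params S" "y = param t"
    and t': "t' \<in> unipotent_params S" "y' = param t'" by blast
  define s where "s z = (\<lambda>x. (1 - z) * t x + z * t' x)" for z :: complex
  have "s z \<in> unipotent_params S" for z
    unfolding unipotent_params_def s_def
    using unipotent_paramsD[OF t(1)] unipotent_paramsD[OF t'(1)] by (auto simp: algebra_simps)
  then have "{z. param (s z) \<notin> param ` unipotent_params S} = {}" by blast
  moreover have "poly_curve n (\<lambda>z. param (s z))"
    unfolding poly_curve_def s_def using box_poly_on_line[OF param_box_poly] by blast
  moreover have "s 0 = t" "s 1 = t'" by (auto simp: s_def)
  ultimately show "\<exists>\<gamma>. poly_curve n \<gamma> \<and> \<gamma> 0 = y \<and> \<gamma> 1 = y' \<and>
      finite {z. \<gamma> z \<notin> param ` unipotent_params S}"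
    using t(2) t'(2) by (intro exI[of _ "\<lambda>z. param (s z)"]) simp
qed

lemma hess_subset_flags: "hess \<subseteq> flags n"
  by (auto simp: Hess_def)

lemma flags_of_params:
  assumes "S \<subseteq> free_index" "t \<in> unipotent_params S"
  shows "flag_of n (param t) \<in> hess"
  using param_mem_X[OF param_GL[OF assms]] by (simp add: X_def)

definition cell :: "(nat \<times> nat) set \<Rightarrow> (nat \<Rightarrow> complex vec set) set" where
  "cell S = subtopology (flag_variety n) hess closure_of (flag_of n ` param ` unipotent_params S)"

lemma irreducible_cell:
  assumes "S \<subseteq> free_index"
  shows "irreducible_space (subtopology (subtopology (flag_variety n) hess) (cell S))"
  unfolding cell_def
proof (rule irreducible_closure_of_prime[OF hess_subset_flags])
  show "param ` unipotent_params S \<subseteq> GL n" using param_GL[OF assms] by blast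
  show "flag_of n ` param ` unipotent_params S \<subseteq> hess" using flags_of_params[OF assms] by blast
  have "(\<lambda>(j, i). if i = j then 1 else 0) \<in> unipotent_params S" by (simp add: unipotent_params_def)
  then show "param ` unipotent_params S \<noteq> {}" by blast
  show "zariski_prime n (param ` unipotent_params S)" by (rule zariski_prime_params[OF assms])
qed

text \<open>The minor on rows \<open>0, ..., j - 1\<close> and \<open>i\<close> equals the new
  coordinate \<open>t (j, i)\<close>: it vanishes on the smaller set and not on the larger
  one.\<close>

lemma cell_strict:
  assumes S: "insert (j, i) S \<subseteq> free_index" and new: "(j, i) \<notin> S"
    and last: "\<And>k r. (k, r) \<in> S \<Longrightarrow> k \<le> j"
  shows "cell S \<subset> cell (insert (j, i) S)"
proof -
  let ?T = "subtopology (flag_variety n) hess"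
  have ji: "(j, i) \<in> free_index" and SF: "S \<subseteq> free_index" using S by auto
  have ij: "j < i" "i < n" using ji m_bounds[of "Suc j"] by (auto simp: free_index_def)
  define \<rho> where "\<rho> = (\<lambda>r. if r < j then r else i)"
  have \<rho>: "\<rho> r < n" if "r < Suc j" for r using ij by (simp add: \<rho>_def)
  have minor: "row_minor \<rho> (Suc j) (param t) = t (j, i)" if t: "t \<in> unipotent_params (insert (j, i) S)" for t
  proof -
    have "row_minor \<rho> (Suc j) (param t) = param t $$ (i, j)"
      unfolding \<rho>_def
      by (rule row_minor_lower_unitriangular[of n]) (use param_unitriangular[OF S t] ij in auto)
    also have "\<dots> = t (j, i)" by (rule param_entry[OF S t ji]) (use last in auto)
    finally show ?thesis .
  qed
  have sub: "unipotent_params S \<subseteq> unipotent_params (insert (j, i) S)"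
    by (auto simp: unipotent_params_def)
  let ?D = "{V \<in> flags n. \<forall>g\<in>GL n. flag_of n g = V \<longrightarrow> row_minor \<rho> (Suc j) g = 0}"
  have "closedin (flag_variety n) ?D"
    using ij \<rho> by (intro closedin_flags_vanishing row_minor_poly) auto
  then have cl: "closedin ?T (?D \<inter> hess)" unfolding closedin_subtopology by blast
  have "flag_of n (param t) \<in> ?D" if t: "t \<in> unipotent_params S" for t
  proof -
    note G = param_GL[OF SF t]
    \<comment> \<open>Another matrix with the same flag is a Borel translate, which changes the
      minor only by a factor.\<close>
    have "row_minor \<rho> (Suc j) g = 0" if g: "g \<in> GL n" "flag_of n g = flag_of n (param t)" for g
    proof -
      obtain b where b: "b \<in> carrier_mat n n" "upper_triangular b" "g = param t * b"
        using flag_of_eq_iff[OF G g(1)] g(2) by blast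
      have "row_minor \<rho> (Suc j) g = row_minor \<rho> (Suc j) (param t) * row_minor (\<lambda>i. i) (Suc j) b"
        unfolding b(3) using ij \<rho> by (intro row_minor_mult_upper_triangular[OF param_carrier b(1,2)]) auto
      also have "row_minor \<rho> (Suc j) (param t) = 0"
        using minor[of t] sub t unipotent_paramsD[OF t new] ij by auto
      finally show ?thesis by simp
    qed
    then show ?thesis using flag_of_in_flags[OF G] by blast
  qed
  then have "cell S \<subseteq> ?D \<inter> hess"
    unfolding cell_def using flags_of_params[OF SF] by (intro closure_of_minimal cl) blast
  moreover have "\<exists>V\<in>cell (insert (j, i) S). V \<notin> ?D"
  proof
    \<comment> \<open>The identity parameters with \<open>1\<close> at the new position, where the
      minor takes the value \<open>1\<close>.\<close>
    define t :: "nat \<times> nat \<Rightarrow> complex" where "t x = (if fst x = snd x \<or> x = (j, i) then 1 else 0)" for x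
    have t: "t \<in> unipotent_params (insert (j, i) S)" by (auto simp: unipotent_params_def t_def)
    have "flag_of n (param t) \<in> hess" by (rule flags_of_params[OF S t])
    have "flag_of n ` param ` unipotent_params (insert (j, i) S) \<subseteq> cell (insert (j, i) S)"
      unfolding cell_def using flags_of_params[OF S] hess_subset_flags
      by (intro closure_of_subset) auto
    then show "flag_of n (param t) \<in> cell (insert (j, i) S)" using t by blast
    have "row_minor \<rho> (Suc j) (param t) \<noteq> 0" using minor[OF t] by (simp add: t_def)
    then show "flag_of n (param t) \<notin> ?D" using param_GL[OF S t] by blast
  qed
  moreover have "cell S \<subseteq> cell (insert (j, i) S)"
    unfolding cell_def using sub by (intro closure_of_mono image_mono)
  ultimately show ?thesis by blast
qed

lemma krull_dim_ge: "enat (\<Sum>i=1..n. m i - i) \<le> krull_dim (subtopology (flag_variety n) hess)"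
proof -
  obtain ys where ys: "set ys = free_index" "distinct ys"
    using finite_distinct_list[OF finite_free_index] by blast
  \<comment> \<open>Sorting by column ensures that, when \<open>(j, i)\<close> is added, all earlier
    positions lie in columns up to \<open>j\<close>, as \<open>cell_strict\<close> requires.
    Starting from the empty set, each position contributes one step of the chain.\<close>
  define xs where "xs = sort_key fst ys"
  have xs: "set xs = free_index" "distinct xs" "sorted (map fst xs)"
    using ys by (simp_all add: xs_def)
  have len: "length xs = (\<Sum>i=1..n. m i - i)"
    using xs(1,2) card_free_index by (metis distinct_card)
  define Z where "Z k = cell (set (take k xs))" for k
  let ?T = "subtopology (flag_variety n) hess"
  have sub: "set (take k xs) \<subseteq> free_index" for k using set_take_subset[of k xs] xs(1) by simp
  have "closedin ?T (Z k)" "irreducible_space (subtopology ?T (Z k))" for k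
    using irreducible_cell[OF sub[of k]] unfolding Z_def by (auto simp: cell_def)
  moreover have "Z k \<subset> Z (Suc k)" if k: "k < length xs" for k
  proof -
    obtain j i where ji: "xs ! k = (j, i)" by fastforce
    have ins: "set (take (Suc k) xs) = insert (j, i) (set (take k xs))"
      using k ji by (simp add: take_Suc_conv_app_nth)
    show ?thesis unfolding Z_def ins
    proof (rule cell_strict)
      show "insert (j, i) (set (take k xs)) \<subseteq> free_index" using sub[of "Suc k"] ins by simp
      show "(j, i) \<notin> set (take k xs)"
      proof
        assume "(j, i) \<in> set (take k xs)"
        then obtain l where "l < k" "xs ! l = xs ! k" using ji by (auto simp: in_set_conv_nth)
        then show False using nth_eq_iff_index_eq[OF xs(2), of l k] k by simp
      qed
      fix c r assume "(c, r) \<in> set (take k xs)"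
      then obtain l where l: "l < k" "xs ! l = (c, r)" by (auto simp: in_set_conv_nth)
      have "map fst xs ! l \<le> map fst xs ! k" using xs(3) l k by (intro sorted_nth_mono) auto
      then show "c \<le> j" using l k ji by simp
    qed
  qed
  ultimately show ?thesis unfolding krull_dim_def len[symmetric] by (intro Sup_upper) blast
qed

end

theorem corollary2:
  fixes p q :: nat and a b :: complex and m :: "nat \<Rightarrow> nat"
  assumes "p \<ge> q" and "q \<ge> 1"
    and "a \<noteq> b"
    and "hessenberg_vector (p + q) m"
    and "irreducible_space (hessenberg_variety (p + q) (diag_two p q a b) m)"
  shows "krull_dim (hessenberg_variety (p + q) (diag_two p q a b) m) =
    enat (\<Sum>i=1..p + q. m i - i)"
proof -
  interpret two_block_hessenberg "p + q" p q a b m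
    using assms by unfold_locales auto
  have sub: "hess \<subseteq> flags (p + q)" by (auto simp: Hess_def)
  \<comment> \<open>Irreducibility enters only as this primality, which gives both the conditions on
    \<open>m\<close> and the cancellation of the minor in \<open>growth_X\<close>.\<close>
  have prime: "zariski_prime (p + q) X"
    using zariski_prime_preimage[OF sub] assms(5) unfolding X_def hessenberg_variety_def by blast
  interpret large_two_block_hessenberg "p + q" p q a b m
    using prime_imp_large[OF prime] by unfold_locales auto
  \<comment> \<open>As \<open>i \<le> m i\<close>, truncated subtraction loses nothing; the sum of
    the \<open>i\<close> is the dimension of the fibres, by which the growth exceeds the length of a
    chain.\<close>
  have "(\<Sum>i=1..p + q. m i) = (\<Sum>i=1..p + q. i) + (\<Sum>i=1..p + q. m i - i)"
    unfolding sum.distrib[symmetric] using m_bounds by (intro sum.cong) auto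
  then have "d \<le> (\<Sum>i=1..p + q. i) + (\<Sum>i=1..p + q. m i - i)"
    if "growth_ge (p + q) {g \<in> GL (p + q). flag_of (p + q) g \<in> hess} d" for d
    using growth_X[OF prime, of d] that by (simp add: X_def)
  from krull_dim_le_growth[OF sub this] show ?thesis
    using krull_dim_ge unfolding hessenberg_variety_def by (rule antisym)
qed

end
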